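(* There are infinitely many $n$ for which there is a cubic graph with $n$ vertices that has a polyhedral embedding on the torus as well as a polyhedral embedding on the orientable surface of genus $\frac{n}{4}-\frac{3}{2}\sqrt{\frac{n}{2}}+1$, and that has (up to mirror images) no other polyhedral embedding.
   Context: Graphs are finite and simple. Embeddings are combinatorial embeddings of connected graphs in closed oriented surfaces: an embedding of $G$ is a rotation system, i.e. an assignment to each vertex of a cyclic order of the directed edges starting there. Each undirected edge is regarded as two inverse directed edges $e,e^{-1}$; $\mathrm{nx}(e)$ is the successor of $e$ in the cyclic order at its start vertex; a face is a cyclic sequence $e_0,\dots,e_{k-1}$ of directed edges with $\mathrm{nx}(e_i^{-1})=e_{(i+1)\bmod k}$ for all $i$. The genus $g$ of an embedding is given by $|V|-|E|+|F|=2-2g$. The mirror image of an embedding reverses the cyclic order at every vertex; when counting different embeddings, mirror images are considered to represent the same embedding. An embedding is polyhedral if each facial walk is a simple cycle and the intersection of any two distinct faces is empty, a single vertex, or a single edge. *)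

theory Defs
  imports Complex_Main "HOL-Combinatorics.Orbits" "Graph_Theory.Graph_Theory"
begin

text \<open>
  A finite simple graph is a \<open>pair_graph\<close>: its set of arcs is a finite, symmetric, irreflexive
  relation. An undirected edge \<open>{u, v}\<close> corresponds to the two mutually inverse directed edges
  \<open>(u, v)\<close> and \<open>(v, u) = prod.swap (u, v)\<close>.
\<close>

definition undirected_edges :: "('a \<times> 'a) set \<Rightarrow> 'a set set" where
  "undirected_edges A = (\<lambda>(u, v). {u, v}) ` A"

definition cubic :: "'a pair_pre_digraph \<Rightarrow> bool" where
  "cubic G \<longleftrightarrow> (\<forall>v \<in> pverts G. out_degree (with_proj G) v = 3)"

text \<open>
  A rotation system is given by its successor function on directed edges. Since a permutation of
  the arcs is the identity outside the arcs, two rotation systems of \<open>G\<close> are equal as functions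
  iff they assign the same cyclic orders.
\<close>

definition rotation_system :: "'a pair_pre_digraph \<Rightarrow> ('a \<times> 'a \<Rightarrow> 'a \<times> 'a) \<Rightarrow> bool" where
  "rotation_system G nx \<longleftrightarrow> nx permutes parcs G \<and>
     (\<forall>v \<in> pverts G. out_arcs (with_proj G) v \<noteq> {} \<longrightarrow> cyclic_on nx (out_arcs (with_proj G) v))"

definition embedding :: "'a pair_pre_digraph \<Rightarrow> ('a \<times> 'a \<Rightarrow> 'a \<times> 'a) \<Rightarrow> bool" where
  "embedding G nx \<longleftrightarrow> pair_graph G \<and> Digraph_Component.connected (with_proj G) \<and> rotation_system G nx"

definition mirror_image :: "('a \<times> 'a \<Rightarrow> 'a \<times> 'a) \<Rightarrow> ('a \<times> 'a \<Rightarrow> 'a \<times> 'a)" where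
  "mirror_image nx = inv nx"

definition same_embedding :: "('a \<times> 'a \<Rightarrow> 'a \<times> 'a) \<Rightarrow> ('a \<times> 'a \<Rightarrow> 'a \<times> 'a) \<Rightarrow> bool" where
  "same_embedding nx nx' \<longleftrightarrow> nx' = nx \<or> nx' = mirror_image nx"

text \<open>
  In a face every directed edge \<open>e\<close> is followed by \<open>nx (e\<^sup>-\<^sup>1)\<close>. This successor function is a
  permutation of the arcs, so a face, as a cyclic sequence, is determined by the set of its
  directed edges, which is an orbit. Faces are represented by these sets.
\<close>

definition face_succ :: "('a \<times> 'a \<Rightarrow> 'a \<times> 'a) \<Rightarrow> ('a \<times> 'a \<Rightarrow> 'a \<times> 'a)" where
  "face_succ nx e = nx (prod.swap e)"

definition faces :: "'a pair_pre_digraph \<Rightarrow> ('a \<times> 'a \<Rightarrow> 'a \<times> 'a) \<Rightarrow> ('a \<times> 'a) set set" where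
  "faces G nx = orbit (face_succ nx) ` parcs G"

definition has_genus :: "'a pair_pre_digraph \<Rightarrow> ('a \<times> 'a \<Rightarrow> 'a \<times> 'a) \<Rightarrow> nat \<Rightarrow> bool" where
  "has_genus G nx g \<longleftrightarrow>
     int (card (pverts G)) - int (card (undirected_edges (parcs G))) + int (card (faces G nx))
       = 2 - 2 * int g"

text \<open>
  The vertices of a facial walk are the start vertices \<open>fst e\<close> of its directed edges, so the walk
  visits no vertex twice iff \<open>fst\<close> is injective on it. The length bound excludes the closed walk
  \<open>e, e\<^sup>-\<^sup>1\<close>, which satisfies the injectivity condition but is not a cycle of a simple graph.
\<close>

definition simple_facial_cycle :: "('a \<times> 'a) set \<Rightarrow> bool" where
  "simple_facial_cycle F \<longleftrightarrow> inj_on fst F \<and> 3 \<le> card F"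

text \<open>
  Faces are intersected as subgraphs, i.e. in their vertices and in their undirected edges; in
  particular, two faces sharing exactly two vertices must also share the edge joining them.
\<close>

definition proper_face_intersection :: "('a \<times> 'a) set \<Rightarrow> ('a \<times> 'a) set \<Rightarrow> bool" where
  "proper_face_intersection F F' \<longleftrightarrow>
     (let W = fst ` F \<inter> fst ` F'; D = undirected_edges F \<inter> undirected_edges F' in
        (W = {} \<and> D = {}) \<or>
        (\<exists>v. W = {v} \<and> D = {}) \<or>
        (\<exists>u v. u \<noteq> v \<and> W = {u, v} \<and> D = {{u, v}}))"

definition polyhedral_embedding :: "'a pair_pre_digraph \<Rightarrow> ('a \<times> 'a \<Rightarrow> 'a \<times> 'a) \<Rightarrow> bool" where
  "polyhedral_embedding G nx \<longleftrightarrow> embedding G nx \<and>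
     (\<forall>F \<in> faces G nx. simple_facial_cycle F) \<and>
     (\<forall>F \<in> faces G nx. \<forall>F' \<in> faces G nx. F \<noteq> F' \<longrightarrow> proper_face_intersection F F')"

end

theory Submission
  imports Defs "HOL-Library.Countable"
begin

text \<open>
  Take the \<open>m \<times> m\<close> hexagonal grid on the torus with \<open>m \<equiv> 1 (mod 3)\<close>: it has \<open>n = 2 m\<^sup>2\<close> vertices and
  \<open>m\<^sup>2\<close> hexagonal faces. Its second embedding is the Petrie dual, whose faces are the \<open>3 m\<close> zigzags; it
  is orientable since the graph is bipartite.

  The graph is properly 3-edge-coloured, so a rotation system is an assignment of a sign to every
  vertex: at \<open>v\<close> the colours are traversed in the order \<open>C0 C1 C2\<close> or in the opposite order. Faces that
  meet more than once exclude most sign patterns on a hexagon: besides hexagons with constant signs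
  and hexagons with alternating signs, only those are left in which exactly two edges, at distance
  one, have ends of equal sign, and then the hexagons across these two edges have constant signs. If
  two adjacent hexagons have constant signs, all signs agree. If constant hexagons exist but are
  never adjacent, they form a pattern of period 3, contradicting \<open>m \<equiv> 1 (mod 3)\<close>. If there are none,
  the signs alternate along every edge. These are the two given embeddings, up to mirror images.
\<close>

section \<open>Embeddings of 3-edge-coloured cubic graphs\<close>

datatype colour = C0 | C1 | C2

fun turn :: "bool \<Rightarrow> colour \<Rightarrow> colour" where
  "turn True C0 = C1" | "turn True C1 = C2" | "turn True C2 = C0"
| "turn False C0 = C2" | "turn False C1 = C0" | "turn False C2 = C1"

lemma UNIV_colour: "(UNIV :: colour set) = {C0, C1, C2}"
  by (auto intro: colour.exhaust)

lemma finite_colour [simp]: "finite (A :: colour set)"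
  by (rule finite_subset[of _ "{C0, C1, C2}"]) (auto intro: colour.exhaust)

lemma all_colour: "(\<forall>k. P k) \<longleftrightarrow> P C0 \<and> P C1 \<and> P C2"
  by (metis colour.exhaust)

lemma ex_colour: "(\<exists>k. P k) \<longleftrightarrow> P C0 \<or> P C1 \<or> P C2"
  by (metis colour.exhaust)

lemma turn_turn [simp]: "turn s (turn s k) = turn (\<not> s) k"
  by (cases s; cases k) auto

lemma turn_turn_Not [simp]: "turn s (turn (\<not> s) k) = k" "turn (\<not> s) (turn s k) = k"
  by (cases s; cases k; simp)+

lemma turn_neq [simp]: "turn s k \<noteq> k" "k \<noteq> turn s k" "turn s k \<noteq> turn (\<not> s) k" "turn (\<not> s) k \<noteq> turn s k"
  by (cases s; cases k; simp)+

lemma turn_inj [simp]: "turn s k = turn s l \<longleftrightarrow> k = l"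
  by (metis turn_turn_Not)

lemma turn_cases: "l = k \<or> l = turn s k \<or> l = turn (\<not> s) k"
  by (cases s; cases k; cases l) auto

lemma third_colour: "distinct [i, j, k] \<Longrightarrow> l = i \<or> l = j \<or> l = (k :: colour)"
  by (cases i; cases j; cases k; cases l) auto

text \<open>Each colour class is a perfect matching, given by the involution \<open>r k\<close> that
  exchanges the ends of its edges, so an arc amounts to a vertex with a colour.
  \<open>V_induct\<close> is connectedness.\<close>

locale coloured_cubic =
  fixes V :: "'v set" and r :: "colour \<Rightarrow> 'v \<Rightarrow> 'v"
  assumes finite_V: "finite V" and V_nonempty: "V \<noteq> {}"
    and r_in [simp]: "v \<in> V \<Longrightarrow> r k v \<in> V"
    and r_r [simp]: "v \<in> V \<Longrightarrow> r k (r k v) = v"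
    and r_neq: "v \<in> V \<Longrightarrow> r k v \<noteq> v"
    and r_eq_iff [simp]: "v \<in> V \<Longrightarrow> r k v = r l v \<longleftrightarrow> k = l"
    and V_induct: "u \<in> V \<Longrightarrow> P u \<Longrightarrow> (\<And>v k. v \<in> V \<Longrightarrow> P v \<Longrightarrow> P (r k v)) \<Longrightarrow> v \<in> V \<Longrightarrow> P v"
begin

section \<open>The graph formed by the three matchings\<close>

definition G :: "'v pair_pre_digraph" where
  "G = \<lparr>pverts = V, parcs = {(v, r k v) | v k. v \<in> V}\<rparr>"

lemma pverts_G [simp]: "pverts G = V"
  by (simp add: G_def)

lemma parcs_G: "parcs G = {(v, r k v) | v k. v \<in> V}"
  by (simp add: G_def)

lemma arc_G [simp]: "v \<in> V \<Longrightarrow> (v, r k v) \<in> parcs G"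
  by (auto simp: parcs_G)

lemma arcs_image: "parcs G = (\<lambda>(v, k). (v, r k v)) ` (V \<times> UNIV)"
  by (auto simp: parcs_G)

lemma finite_arcs: "finite (parcs G)"
  unfolding arcs_image using finite_V by (intro finite_imageI finite_cartesian_product) auto

lemma pair_graph_G: "pair_graph G"
proof
  show "finite (pverts G)" using finite_V by simp
  show "finite (parcs G)" by (rule finite_arcs)
  show "symmetric (with_proj G)"
  proof -
    have "sym (parcs G)"
      by (rule symI) (auto simp: parcs_G, metis r_in r_r)
    then show ?thesis by (simp add: symmetric_def)
  qed
qed (use r_neq in \<open>auto simp: parcs_G eq_commute\<close>)

lemma out_arcs_G: "v \<in> V \<Longrightarrow> out_arcs (with_proj G) v = (\<lambda>k. (v, r k v)) ` UNIV"
  by (auto simp: out_arcs_def parcs_G)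

lemma cubic_G: "cubic G"
proof -
  have "card ((\<lambda>k. (v, r k v)) ` UNIV) = 3" if "v \<in> V" for v
    using that by (simp add: card_image inj_on_def) (simp add: UNIV_colour)
  then show ?thesis
    by (simp add: cubic_def out_degree_def out_arcs_G)
qed

lemma connected_G: "Digraph_Component.connected (with_proj G)"
proof -
  interpret pair_graph G by (rule pair_graph_G)
  have "u \<rightarrow>\<^sup>*\<^bsub>with_proj G\<^esub> v" if "u \<in> V" "v \<in> V" for u v
    using that(1) _ _ that(2)
  proof (rule V_induct)
    show "u \<rightarrow>\<^sup>*\<^bsub>with_proj G\<^esub> u" using that by (simp add: reachable_def)
  next
    fix v k assume "v \<in> V" "u \<rightarrow>\<^sup>*\<^bsub>with_proj G\<^esub> v"
    then show "u \<rightarrow>\<^sup>*\<^bsub>with_proj G\<^esub> r k v"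
      unfolding reachable_def by (auto intro: rtrancl_on_into_rtrancl_on)
  qed
  then have "u \<rightarrow>\<^sup>*\<^bsub>with_proj (mk_symmetric G)\<^esub> v" if "u \<in> V" "v \<in> V" for u v
    using that by (intro reachable_mk_symmetricI)
  then show ?thesis
    using V_nonempty by (simp add: Digraph_Component.connected_def strongly_connected_def)
qed

section \<open>Rotation systems as sign functions\<close>

definition edge_colour :: "'v \<times> 'v \<Rightarrow> colour" where
  "edge_colour e = (THE k. snd e = r k (fst e))"

lemma edge_colour [simp]: "v \<in> V \<Longrightarrow> edge_colour (v, r k v) = k"
  by (simp add: edge_colour_def)

definition rot :: "('v \<Rightarrow> bool) \<Rightarrow> 'v \<times> 'v \<Rightarrow> 'v \<times> 'v" where
  "rot s e = (if e \<in> parcs G then (fst e, r (turn (s (fst e)) (edge_colour e)) (fst e)) else e)"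

lemma rot_arc [simp]: "v \<in> V \<Longrightarrow> rot s (v, r k v) = (v, r (turn (s v) k) v)"
  by (simp add: rot_def)

lemma rot_arc_swap [simp]: "v \<in> V \<Longrightarrow> rot s (r k v, v) = (r k v, r (turn (s (r k v)) k) (r k v))"
  using rot_arc[of "r k v" s k] by simp

lemma rot_outside: "e \<notin> parcs G \<Longrightarrow> rot s e = e"
  by (simp add: rot_def)

lemma arcE: "e \<in> parcs G \<Longrightarrow> (\<And>v k. e = (v, r k v) \<Longrightarrow> v \<in> V \<Longrightarrow> P) \<Longrightarrow> P"
  by (auto simp: parcs_G)

lemma rot_rot_Not: "rot s (rot (\<lambda>v. \<not> s v) e) = e"
proof (cases "e \<in> parcs G")
  case True
  then show ?thesis by (auto elim!: arcE)
qed (simp add: rot_outside)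

lemma rot_cong: "(\<And>v. v \<in> V \<Longrightarrow> s v = s' v) \<Longrightarrow> rot s = rot s'"
  by (rule ext) (auto simp: rot_def parcs_G)

lemma inv_rot: "inv (rot s) = rot (\<lambda>v. \<not> s v)"
  using rot_rot_Not[of s] rot_rot_Not[of "\<lambda>v. \<not> s v"]
  by (intro inv_equality) auto

lemma rot_permutes: "rot s permutes parcs G"
proof (rule bij_imp_permutes)
  have *: "rot s ` parcs G \<subseteq> parcs G" for s
    by (auto elim!: arcE)
  show "bij_betw (rot s) (parcs G) (parcs G)"
    by (rule bij_betw_byWitness[where f' = "rot (\<lambda>v. \<not> s v)"])
      (use * rot_rot_Not[of s] rot_rot_Not[of "\<lambda>v. \<not> s v"] in auto)
qed (simp add: rot_outside)

lemma rotation_system_rot: "rotation_system G (rot s)"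
proof -
  have "cyclic_on (rot s) ((\<lambda>k. (v, r k v)) ` UNIV)" if v: "v \<in> V" for v
  proof -
    have sub: "orbit (rot s) (v, r C0 v) \<subseteq> (\<lambda>k. (v, r k v)) ` UNIV"
    proof
      fix e assume "e \<in> orbit (rot s) (v, r C0 v)"
      then show "e \<in> (\<lambda>k. (v, r k v)) ` UNIV"
        by induct (use v in auto)
    qed
    have 1: "(v, r (turn (s v) C0) v) \<in> orbit (rot s) (v, r C0 v)"
      using orbit.base[of "rot s" "(v, r C0 v)"] v by simp
    then have 2: "(v, r (turn (\<not> s v) C0) v) \<in> orbit (rot s) (v, r C0 v)"
      using orbit.step[OF 1] v by simp
    then have 3: "(v, r C0 v) \<in> orbit (rot s) (v, r C0 v)"
      using orbit.step[OF 2] v by simp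
    have "(v, r k v) \<in> orbit (rot s) (v, r C0 v)" for k
      using 1 2 3 turn_cases[of k C0 "s v"] by auto
    then have "orbit (rot s) (v, r C0 v) = (\<lambda>k. (v, r k v)) ` UNIV"
      using sub by auto
    then show ?thesis
      by (metis cyclic_on_def rangeI)
  qed
  then show ?thesis
    by (simp add: rotation_system_def rot_permutes out_arcs_G)
qed

lemma embedding_rot: "embedding G (rot s)"
  by (simp add: embedding_def pair_graph_G connected_G rotation_system_rot)

lemma rotation_systemE:
  assumes "rotation_system G nx"
  obtains s where "nx = rot s"
proof -
  have perm: "nx permutes parcs G"
    using assms by (simp add: rotation_system_def)
  have "\<exists>s. \<forall>k. nx (v, r k v) = (v, r (turn s k) v)" if v: "v \<in> V" for v
  proof -
    let ?O = "(\<lambda>k. (v, r k v)) ` UNIV"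
    have cyc: "cyclic_on nx ?O"
      using assms v by (simp add: rotation_system_def out_arcs_G)
    have "\<exists>l. nx (v, r k v) = (v, r l v)" for k
      using cyclic_on_inI[OF cyc, of "(v, r k v)"] by auto
    then obtain f where f: "\<And>k. nx (v, r k v) = (v, r (f k) v)" by metis
    have inj: "f k = f l \<Longrightarrow> k = l" for k l
      using f[of k] f[of l] v permutes_inj[OF perm]
      by (metis injD prod.inject r_eq_iff)
    \<comment> \<open>The arcs at \<open>v\<close> form a single orbit, so no proper nonempty set of
      colours is invariant; applied to singletons, this excludes fixed points.\<close>
    have closed: "S = UNIV" if "S \<noteq> {}" "f ` S \<subseteq> S" for S
    proof -
      from \<open>S \<noteq> {}\<close> obtain k where k: "k \<in> S" by auto
      have "e \<in> (\<lambda>k. (v, r k v)) ` S" if "e \<in> orbit nx (v, r k v)" for e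
        using that by induct (use k f \<open>f ` S \<subseteq> S\<close> in auto)
      moreover have "orbit nx (v, r k v) = ?O"
        by (rule orbit_cyclic_eq3[OF cyc]) auto
      ultimately have "(v, r l v) \<in> (\<lambda>k. (v, r k v)) ` S" for l by blast
      then show ?thesis using v by (fastforce simp: set_eq_iff)
    qed
    have ne: "f k \<noteq> k" for k
    proof
      assume "f k = k"
      then have "{k} = UNIV" by (intro closed) auto
      moreover have "turn True k \<notin> {k}" by simp
      ultimately show False by blast
    qed
    \<comment> \<open>An injection of three colours without fixed points is one of the two
      3-cycles.\<close>
    have "f = turn True \<or> f = turn False"
      unfolding fun_eq_iff all_colour
      using ne[of C0] ne[of C1] ne[of C2] inj[of C0 C1] inj[of C0 C2] inj[of C1 C2]
      by (cases "f C0"; cases "f C1"; cases "f C2") simp_all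
    then show ?thesis using f by auto
  qed
  then obtain s where s: "\<And>v k. v \<in> V \<Longrightarrow> nx (v, r k v) = (v, r (turn (s v) k) v)" by metis
  have "nx = rot s"
  proof
    fix e show "nx e = rot s e"
    proof (cases "e \<in> parcs G")
      case True then show ?thesis by (auto elim!: arcE simp: s)
    next
      case False then show ?thesis
        using perm by (simp add: rot_outside permutes_not_in)
    qed
  qed
  then show ?thesis by (rule that)
qed

section \<open>Face tracing\<close>

text \<open>
  The face that passes through \<open>v\<close> without using the edge of colour \<open>k\<close>.
\<close>

definition face_at :: "('v \<Rightarrow> bool) \<Rightarrow> 'v \<Rightarrow> colour \<Rightarrow> ('v \<times> 'v) set" where
  "face_at s v k = orbit (face_succ (rot s)) (v, r (turn (\<not> s v) k) v)"

lemma face_succ_arc: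
  "v \<in> V \<Longrightarrow> face_succ (rot s) (v, r k v) = (r k v, r (turn (s (r k v)) k) (r k v))"
  using rot_arc[of "r k v" s k] by (simp add: face_succ_def)

lemma orbit_arc_eq:
  "v \<in> V \<Longrightarrow> orbit (face_succ (rot s)) (v, r k v) = face_at s v (turn (s v) k)"
  by (simp add: face_at_def)

text \<open>Outside the arcs \<open>face_succ\<close> swaps pairs. Replacing it there by the
  identity gives a permutation of a finite set, to which the theory of orbits applies.\<close>

lemma face_succ_permutes:
  "(\<lambda>e. if e \<in> parcs G then face_succ (rot s) e else e) permutes parcs G" (is "?f permutes _")
proof (rule bij_imp_permutes)
  let ?g = "\<lambda>e. prod.swap (rot (\<lambda>v. \<not> s v) e)"
  have *: "(r k v, v) \<in> parcs G" if "v \<in> V" for v k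
    using arc_G[of "r k v" k] that by simp
  show "bij_betw ?f (parcs G) (parcs G)"
    by (rule bij_betw_byWitness[where f' = ?g])
      (use rot_rot_Not[of s] rot_rot_Not[of "\<lambda>v. \<not> s v"] in
        \<open>auto elim!: arcE simp: face_succ_arc * simp: face_succ_def\<close>)
qed simp

lemma orbit_face_succ:
  assumes "e \<in> parcs G"
  shows "orbit (face_succ (rot s)) e
       = orbit (\<lambda>e. if e \<in> parcs G then face_succ (rot s) e else e) e"
  by (rule orbit_cong0[OF assms]) (auto elim!: arcE simp: face_succ_arc)

lemma face_orbit_props:
  assumes "e \<in> parcs G"
  shows face_orbit_self: "e \<in> orbit (face_succ (rot s)) e"
    and face_orbit_subset: "orbit (face_succ (rot s)) e \<subseteq> parcs G"
    and face_orbit_eq: "e' \<in> orbit (face_succ (rot s)) e \<Longrightarrow>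
           orbit (face_succ (rot s)) e' = orbit (face_succ (rot s)) e"
proof -
  let ?f = "\<lambda>e. if e \<in> parcs G then face_succ (rot s) e else e"
  have perm: "permutation ?f"
    using face_succ_permutes finite_arcs permutation_permutes by blast
  show "e \<in> orbit (face_succ (rot s)) e"
    using permutation_self_in_orbit[OF perm] assms by (simp add: orbit_face_succ)
  show sub: "orbit (face_succ (rot s)) e \<subseteq> parcs G"
    using permutes_orbit_subset[OF face_succ_permutes assms] assms by (simp add: orbit_face_succ)
  show "orbit (face_succ (rot s)) e' = orbit (face_succ (rot s)) e"
    if "e' \<in> orbit (face_succ (rot s)) e"
  proof -
    have e': "e' \<in> parcs G" using that sub by auto
    have "e' \<in> orbit ?f e" using that assms by (simp only: orbit_face_succ)
    then have "orbit ?f e' = orbit ?f e"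
      by (rule orbit_cyclic_eq3[OF cyclic_on_orbit'[OF perm]])
    then show ?thesis using assms e' by (simp only: orbit_face_succ)
  qed
qed

text \<open>Orbits partition the arcs; leaving \<open>v\<close> along \<open>c\<close>, a face
  avoids \<open>turn (s v) c\<close>.\<close>

lemma mem_face_at:
  assumes "v \<in> V" "x \<in> V"
  shows "(v, r c v) \<in> face_at s x i \<longleftrightarrow> face_at s v (turn (s v) c) = face_at s x i"
proof
  assume "(v, r c v) \<in> face_at s x i"
  then show "face_at s v (turn (s v) c) = face_at s x i"
    using face_orbit_eq[of "(x, r (turn (\<not> s x) i) x)" "(v, r c v)" s] assms
    by (simp add: face_at_def)
next
  assume "face_at s v (turn (s v) c) = face_at s x i"
  then show "(v, r c v) \<in> face_at s x i"
    using face_orbit_self[of "(v, r c v)" s] assms by (simp add: face_at_def)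
qed

lemma face_at_subset: "v \<in> V \<Longrightarrow> face_at s v k \<subseteq> parcs G"
  unfolding face_at_def by (rule face_orbit_subset) simp

lemma fst_face_at:
  assumes "x \<in> V"
  shows "v \<in> fst ` face_at s x i \<longleftrightarrow> v \<in> V \<and> (\<exists>j. face_at s v j = face_at s x i)"
proof
  assume "v \<in> fst ` face_at s x i"
  then obtain e where e: "e \<in> face_at s x i" "v = fst e" by auto
  moreover have "e \<in> parcs G" using e face_at_subset assms by blast
  ultimately obtain k where "v \<in> V" "(v, r k v) \<in> face_at s x i" by (auto elim: arcE)
  then show "v \<in> V \<and> (\<exists>j. face_at s v j = face_at s x i)"
    using assms by (auto simp: mem_face_at)
next
  assume v: "v \<in> V \<and> (\<exists>j. face_at s v j = face_at s x i)"
  then obtain j where "face_at s v (turn (s v) (turn (\<not> s v) j)) = face_at s x i" by auto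
  then have "(v, r (turn (\<not> s v) j) v) \<in> face_at s x i"
    using v assms by (simp add: mem_face_at)
  then show "v \<in> fst ` face_at s x i" by force
qed

lemma faces_eq: "faces G (rot s) = (\<lambda>(v, k). face_at s v k) ` (V \<times> UNIV)"
proof -
  have "orbit (face_succ (rot s)) (v, r k v) \<in> (\<lambda>(v, k). face_at s v k) ` (V \<times> UNIV)"
    if "v \<in> V" for v k
    using that by (auto simp: orbit_arc_eq)
  moreover have "face_at s v k \<in> faces G (rot s)" if "v \<in> V" for v k
    using that by (auto simp: face_at_def faces_def)
  ultimately show ?thesis by (auto simp: faces_def elim!: arcE)
qed

text \<open>Having arrived along \<open>c\<close>, a face leaves by the next colour in the local
  order, so it avoids the previous one.\<close>

lemma face_at_step:
  assumes "v \<in> V"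
  shows "face_at s v (turn (s v) c) = face_at s (r c v) (turn (\<not> s (r c v)) c)"
proof -
  have "face_succ (rot s) (v, r c v) \<in> face_at s v (turn (s v) c)"
    unfolding face_at_def by (simp add: orbit.base)
  then have "(r c v, r (turn (s (r c v)) c) (r c v)) \<in> face_at s v (turn (s v) c)"
    using assms by (simp add: face_succ_arc)
  then show ?thesis
    using assms by (simp add: mem_face_at)
qed

text \<open>Opposite cyclic orders at the two ends cancel the difference between leaving and
  arriving, so the avoided colour persists. With equal signs, as in \<open>face_at_cis\<close>, the
  two possible colours are exchanged.\<close>

lemma face_at_trans:
  assumes "v \<in> V" "s v \<noteq> s (r c v)" "k \<noteq> c"
  shows "face_at s (r c v) k = face_at s v k"
proof -
  have eq: "(\<not> s (r c v)) = s v" "s (r c v) = (\<not> s v)" using assms by auto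
  have "k = turn (s v) c \<or> k = turn (\<not> s v) c"
    using turn_cases[of k c] assms by blast
  then show ?thesis
    using face_at_step[OF assms(1), of s c] face_at_step[of "r c v" s c] assms(1) eq by auto
qed

lemma face_at_cis:
  assumes "v \<in> V" "s v = s (r c v)" "distinct [c, k, l]"
  shows "face_at s (r c v) l = face_at s v k"
proof -
  have "k = turn (s v) c \<and> l = turn (\<not> s v) c \<or> k = turn (\<not> s v) c \<and> l = turn (s v) c"
    using turn_cases[of k c] turn_cases[of l c] assms by fastforce
  then show ?thesis
    using face_at_step[OF assms(1), of s c] face_at_step[of "r c v" s c] assms(1,2) by auto
qed

text \<open>Induction along the orbit. Invariants of this kind later tell faces apart and count
  them.\<close>

lemma face_at_constant:
  assumes step: "\<And>v c. v \<in> V \<Longrightarrow> L (r c v) (turn (\<not> s (r c v)) c) = L v (turn (s v) c)"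
    and "v \<in> V" "w \<in> V" "face_at s w l = face_at s v k"
  shows "L w l = L v k"
proof -
  have *: "x \<in> V \<and> (\<exists>c. y = r c x \<and> L x (turn (s x) c) = L v k)"
    if "(x, y) \<in> face_at s v k" for x y
  proof -
    have "\<exists>x c. e = (x, r c x) \<and> x \<in> V \<and> L x (turn (s x) c) = L v k"
      if "e \<in> orbit (face_succ (rot s)) (v, r (turn (\<not> s v) k) v)" for e
      using that
    proof induct
      case base
      show ?case
        using step[OF \<open>v \<in> V\<close>, of "turn (\<not> s v) k"] \<open>v \<in> V\<close> by (force simp: face_succ_arc)
    next
      case (step e)
      then obtain x c where "e = (x, r c x)" "x \<in> V" "L x (turn (s x) c) = L v k" by auto
      then show ?case
        using assms(1)[of x c] by (force simp: face_succ_arc)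
    qed
    then show ?thesis using that by (fastforce simp: face_at_def)
  qed
  have "(w, r (turn (\<not> s w) l) w) \<in> face_at s v k"
    using assms by (simp add: mem_face_at)
  then show ?thesis
    using *[of w "r (turn (\<not> s w) l) w"] \<open>w \<in> V\<close> by auto
qed

section \<open>Common vertices and edges of faces; polyhedrality in terms of signs\<close>

lemma edge_in_face_at:
  assumes "v \<in> V" "k \<noteq> i"
  shows "(v, r k v) \<in> face_at s v i \<or> (r k v, v) \<in> face_at s v i"
proof -
  consider "i = turn (s v) k" | "i = turn (\<not> s v) k"
    using turn_cases[of i k "s v"] assms by blast
  then show ?thesis
  proof cases
    case 1
    then show ?thesis using assms by (simp add: mem_face_at)
  next
    case 2
    then have "face_at s (r k v) (turn (s (r k v)) k) = face_at s v i"
      using face_at_step[of "r k v" s k] assms by simp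
    then have "(r k v, r k (r k v)) \<in> face_at s v i"
      using assms by (subst mem_face_at) auto
    then show ?thesis using assms by simp
  qed
qed

lemma neighbour_in_face_at:
  assumes "v \<in> V" "k \<noteq> i"
  shows "r k v \<in> fst ` face_at s v i"
proof -
  consider "(v, r k v) \<in> face_at s v i" | "(r k v, v) \<in> face_at s v i"
    using edge_in_face_at[OF assms] by blast
  then show ?thesis
  proof cases
    case 1
    then have "face_at s (r k v) (turn (\<not> s (r k v)) k) = face_at s v i"
      using assms face_at_step[of v s k] by (simp add: mem_face_at)
    then show ?thesis using assms by (subst fst_face_at) auto
  next
    case 2
    then show ?thesis by force
  qed
qed

text \<open>In a cubic graph two faces that meet in a vertex share an edge there. So the
  intersection condition only has to forbid further common vertices; injectivity at each vertex
  means that facial walks are simple.\<close>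

definition proper_signs :: "('v \<Rightarrow> bool) \<Rightarrow> bool" where
  "proper_signs s \<longleftrightarrow>
     (\<forall>v\<in>V. inj (face_at s v)) \<and>
     (\<forall>v\<in>V. \<forall>x\<in>V. \<forall>i j k i' j'. distinct [i, j, k] \<longrightarrow> face_at s v i = face_at s x i' \<longrightarrow>
        face_at s v j = face_at s x j' \<longrightarrow> x = v \<or> x = r k v)"

lemma undirected_edges_face_at:
  assumes "v \<in> V" "D \<in> undirected_edges (face_at s v i)"
  shows "card D = 2" "D \<subseteq> fst ` face_at s v i"
proof -
  obtain x y where D: "D = {x, y}" "(x, y) \<in> face_at s v i"
    using assms by (auto simp: undirected_edges_def)
  then have "(x, y) \<in> parcs G" using face_at_subset assms by blast
  then obtain k where k: "x \<in> V" "y = r k x" by (auto simp: parcs_G)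
  have eq: "face_at s x (turn (s x) k) = face_at s v i"
    using D k assms by (simp add: mem_face_at)
  then have "y \<in> fst ` face_at s v i"
    using neighbour_in_face_at[of x k "turn (s x) k" s] k by simp
  moreover have "x \<in> fst ` face_at s v i" using D by force
  ultimately show "D \<subseteq> fst ` face_at s v i" using D by simp
  show "card D = 2" using D k r_neq[of x k] by simp
qed

text \<open>Both faces contain the two ends of the edge of colour \<open>k\<close> at
  \<open>v\<close>, so only the third case of \<open>proper_face_intersection\<close> remains, which
  allows no other common vertex.\<close>

lemma polyhedral_rot_imp_proper_signs:
  assumes "polyhedral_embedding G (rot s)"
  shows "proper_signs s"
proof -
  have F: "face_at s v i \<in> faces G (rot s)" if "v \<in> V" for v i
    using that by (auto simp: faces_eq)
  have inj: "inj (face_at s v)" if v: "v \<in> V" for v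
  proof (rule injI)
    fix i j assume eq: "face_at s v i = face_at s v j"
    have "inj_on fst (face_at s v i)"
      using assms F[OF v] by (auto simp: polyhedral_embedding_def simple_facial_cycle_def)
    moreover have "fst (v, r (turn (\<not> s v) i) v) = fst (v, r (turn (\<not> s v) j) v)" by simp
    moreover have "(v, r (turn (\<not> s v) i) v) \<in> face_at s v i" "(v, r (turn (\<not> s v) j) v) \<in> face_at s v i"
      using v eq by (auto simp: mem_face_at)
    ultimately have "(v, r (turn (\<not> s v) i) v) = (v, r (turn (\<not> s v) j) v)"
      by (rule inj_onD)
    then show "i = j" using v by simp
  qed
  moreover have "x = v \<or> x = r k v"
    if v: "v \<in> V" and x: "x \<in> V" and ijk: "distinct [i, j, k]"
      and eq: "face_at s v i = face_at s x i'" "face_at s v j = face_at s x j'" for v x i j k i' j'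
  proof -
    have "face_at s v i \<noteq> face_at s v j"
      using inj[OF v] ijk by (auto dest: injD)
    then have "proper_face_intersection (face_at s v i) (face_at s v j)"
      using assms F v by (auto simp: polyhedral_embedding_def)
    moreover have "v \<in> fst ` face_at s v i \<inter> fst ` face_at s v j"
      using v by (auto simp: fst_face_at)
    moreover have "r k v \<in> fst ` face_at s v i \<inter> fst ` face_at s v j"
      using v ijk neighbour_in_face_at by auto
    moreover have "x \<in> fst ` face_at s v i \<inter> fst ` face_at s v j"
      using x v eq fst_face_at[of v x s i] fst_face_at[of v x s j] by auto
    moreover have "r k v \<noteq> v" using v by (rule r_neq)
    ultimately show ?thesis
      unfolding proper_face_intersection_def Let_def by (elim disjE exE conjE) auto
  qed
  ultimately show ?thesis by (auto simp: proper_signs_def)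
qed

lemma proper_signs_imp_polyhedral_rot:
  assumes "proper_signs s"
  shows "polyhedral_embedding G (rot s)"
proof -
  have inj: "i = j" if "v \<in> V" "face_at s v i = face_at s v j" for v i j
    using assms that by (auto simp: proper_signs_def dest: injD)
  have "simple_facial_cycle (face_at s x i)" if x: "x \<in> V" for x i
  proof -
    let ?F = "face_at s x i"
    have inj_fst: "inj_on fst ?F"
    proof (rule inj_onI)
      fix e e' assume e: "e \<in> ?F" "e' \<in> ?F" "fst e = fst e'"
      then obtain v k l where v: "v \<in> V" "e = (v, r k v)" "e' = (v, r l v)"
        using face_at_subset[OF x, of s i] by (metis arcE fst_conv subsetD)
      then have "turn (s v) k = turn (s v) l"
        using e x by (intro inj) (auto simp: mem_face_at)
      then show "e = e'" using v by simp
    qed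
    have "finite ?F"
      using face_at_subset[OF x] finite_arcs by (rule finite_subset)
    \<comment> \<open>\<open>x\<close> and its two neighbours on the face supply the vertices for
      the length bound.\<close>
    moreover have "{x, r (turn True i) x, r (turn False i) x} \<subseteq> fst ` ?F"
      using x neighbour_in_face_at[OF x] by (auto simp: fst_face_at)
    ultimately have "card {x, r (turn True i) x, r (turn False i) x} \<le> card (fst ` ?F)"
      by (intro card_mono) auto
    moreover have "x \<noteq> r k x" for k using r_neq[OF x, of k] by simp
    moreover have "turn True i \<noteq> turn False i" by (cases i) auto
    ultimately have "3 \<le> card (fst ` ?F)" using x by simp
    then show ?thesis
      using inj_fst by (simp add: simple_facial_cycle_def card_image)
  qed
  moreover have "proper_face_intersection (face_at s v i) (face_at s w j)"
    if v: "v \<in> V" and w: "w \<in> V" and ne: "face_at s v i \<noteq> face_at s w j" for v w i j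
  proof (cases "fst ` face_at s v i \<inter> fst ` face_at s w j = {}")
    case True
    then have "undirected_edges (face_at s v i) \<inter> undirected_edges (face_at s w j) = {}"
      using undirected_edges_face_at[OF v] undirected_edges_face_at[OF w]
      by (metis Int_iff card.empty equals0I le_inf_iff subset_empty zero_neq_numeral)
    then show ?thesis using True by (simp add: proper_face_intersection_def)
  next
    case False
    then obtain x where "x \<in> fst ` face_at s v i" "x \<in> fst ` face_at s w j" by auto
    then obtain i' j' where x: "x \<in> V"
      and eq: "face_at s v i = face_at s x i'" "face_at s w j = face_at s x j'"
      using fst_face_at[OF v] fst_face_at[OF w] by metis
    \<comment> \<open>The two faces avoid \<open>i'\<close> and \<open>j'\<close> at
      \<open>x\<close>, so both use the edge of the third colour.\<close>
    define k where "k = (SOME k. k \<noteq> i' \<and> k \<noteq> j')"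
    have "\<exists>k. k \<noteq> i' \<and> k \<noteq> j'"
      by (cases i'; cases j') (auto simp: ex_colour)
    then have "k \<noteq> i' \<and> k \<noteq> j'" unfolding k_def by (rule someI_ex)
    then have k: "distinct [i', j', k]" using ne eq by auto
    define W where "W = fst ` face_at s v i \<inter> fst ` face_at s w j"
    define D where "D = undirected_edges (face_at s v i) \<inter> undirected_edges (face_at s w j)"
    have "W = {x, r k x}"
    proof
      show "W \<subseteq> {x, r k x}"
      proof
        fix y assume "y \<in> W"
        then obtain i'' j'' where "y \<in> V" "face_at s x i' = face_at s y i''" "face_at s x j' = face_at s y j''"
          using x unfolding W_def eq by (auto simp: fst_face_at)
        then show "y \<in> {x, r k x}"
          using assms k x unfolding proper_signs_def by blast
      qed
      show "{x, r k x} \<subseteq> W"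
        using x k neighbour_in_face_at[OF x] unfolding W_def eq by (auto simp: fst_face_at)
    qed
    moreover have "D = {{x, r k x}}"
    proof
      show "D \<subseteq> {{x, r k x}}"
      proof
        fix d assume d: "d \<in> D"
        have "d \<subseteq> W" "card d = 2"
          using undirected_edges_face_at[OF v, of d] undirected_edges_face_at[OF w, of d] d
          unfolding D_def W_def by auto
        moreover have "card {x, r k x} = 2" using r_neq[OF x, of k] by simp
        ultimately show "d \<in> {{x, r k x}}"
          using \<open>W = {x, r k x}\<close> by (metis card_subset_eq finite.emptyI finite_insert singletonI)
      qed
      have "{x, r k x} \<in> undirected_edges (face_at s x l)" if "k \<noteq> l" for l
        using edge_in_face_at[OF x that, of s] by (force simp: undirected_edges_def insert_commute)
      then show "{{x, r k x}} \<subseteq> D"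
        using k unfolding D_def eq by auto
    qed
    moreover have "x \<noteq> r k x" using r_neq[OF x, of k] by simp
    ultimately have "\<exists>u v. u \<noteq> v \<and> W = {u, v} \<and> D = {{u, v}}" by blast
    then show ?thesis
      unfolding proper_face_intersection_def Let_def W_def D_def by (intro disjI2)
  qed
  moreover have "\<exists>v\<in>V. \<exists>i. F = face_at s v i" if "F \<in> faces G (rot s)" for F
    using that by (auto simp: faces_eq)
  ultimately show ?thesis
    unfolding polyhedral_embedding_def using embedding_rot[of s] by metis
qed

end

section \<open>Sign patterns on hexagonal nets\<close>

text \<open>\<open>side\<close> is a bipartition. The \<open>short\<close> conditions exclude closed
  walks of length 4 and 6 that could arise by wrapping around a small torus. The exponent in
  \<open>period\<close> is prime to 3, which will rule out the pattern of period 3.\<close>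

locale hexagonal_net = coloured_cubic +
  fixes side :: "'a \<Rightarrow> bool" and q :: nat
  assumes side_r [simp]: "v \<in> V \<Longrightarrow> side (r k v) \<longleftrightarrow> \<not> side v"
    and hexagon_closed: "v \<in> V \<Longrightarrow> distinct [a, b, c] \<Longrightarrow> r b (r a (r c (r b (r a (r c v))))) = v"
    and short1: "v \<in> V \<Longrightarrow> distinct [a, b, c] \<Longrightarrow> r b (r a (r c v)) \<noteq> r a v"
    and short2: "v \<in> V \<Longrightarrow> distinct [a, b, c] \<Longrightarrow> r b (r c (r b v)) \<noteq> r c v"
    and short3: "v \<in> V \<Longrightarrow> distinct [a, b, c] \<Longrightarrow> r a (r b (r c (r b v))) \<noteq> r b (r c v)"
    and period: "v \<in> V \<Longrightarrow> a \<noteq> c \<Longrightarrow> ((\<lambda>v. r c (r a v)) ^^ (3 * q + 1)) v = v"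
begin

text \<open>\<open>a\<close>, \<open>b\<close>, \<open>c\<close> are the colours that point out of
  the hexagon at \<open>v0\<close>, \<open>v1\<close>, \<open>v2\<close> and again at
  \<open>v3\<close>, \<open>v4\<close>, \<open>v5\<close>. A shift by one vertex thus permutes them
  cyclically.\<close>

definition hexagon :: "'a \<Rightarrow> 'a \<Rightarrow> 'a \<Rightarrow> 'a \<Rightarrow> 'a \<Rightarrow> 'a \<Rightarrow> colour \<Rightarrow> colour \<Rightarrow> colour \<Rightarrow> bool" where
  "hexagon v0 v1 v2 v3 v4 v5 a b c \<longleftrightarrow> v0 \<in> V \<and> distinct [a, b, c] \<and>
     v1 = r c v0 \<and> v2 = r a v1 \<and> v3 = r b v2 \<and> v4 = r c v3 \<and> v5 = r a v4"

lemma hexagonI: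
  assumes "v \<in> V" "distinct [a, b, c]"
  obtains v1 v2 v3 v4 v5 where "hexagon v v1 v2 v3 v4 v5 a b c"
  using assms by (auto simp: hexagon_def)

lemma hexagon_shift:
  assumes "hexagon v0 v1 v2 v3 v4 v5 a b c"
  shows "hexagon v1 v2 v3 v4 v5 v0 b c a"
proof -
  have "r b v5 = v0"
    using assms hexagon_closed[of v0 a b c] by (simp add: hexagon_def)
  then show ?thesis
    using assms by (auto simp: hexagon_def)
qed

lemma hexagon_flip:
  assumes "hexagon v0 v1 v2 v3 v4 v5 a b c"
  shows "hexagon v0 v5 v4 v3 v2 v1 a c b"
proof -
  have in_V: "v0 \<in> V" "v1 \<in> V" "v2 \<in> V" "v3 \<in> V" "v4 \<in> V" "v5 \<in> V" and d: "distinct [a, c, b]"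
    and e: "v1 = r c v0" "v2 = r a v1" "v3 = r b v2" "v4 = r c v3" "v5 = r a v4"
    using assms by (auto simp: hexagon_def)
  have "r b v5 = v0"
    using assms hexagon_closed[of v0 a b c] by (simp add: hexagon_def)
  then have "v5 = r b v0" using r_r[OF in_V(6), of b] by simp
  moreover have "v4 = r a v5" "v3 = r c v4" "v2 = r b v3" "v1 = r a v2"
    using in_V e by (metis r_r)+
  ultimately show ?thesis
    using in_V(1) d unfolding hexagon_def by blast
qed

lemma hexagon_in:
  assumes "hexagon v0 v1 v2 v3 v4 v5 a b c"
  shows "v0 \<in> V" "v1 \<in> V" "v2 \<in> V" "v3 \<in> V" "v4 \<in> V" "v5 \<in> V"
  using assms by (auto simp: hexagon_def)

text \<open>Vertices two steps apart differ because the colours of the two steps do; parity under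
  \<open>side\<close> and \<open>short1\<close> give the rest.\<close>

lemma hexagon_distinct:
  assumes h: "hexagon v0 v1 v2 v3 v4 v5 a b c"
  shows "v2 \<noteq> v0" "v3 \<noteq> v0" "v4 \<noteq> v0" "v3 \<noteq> v1" "v4 \<noteq> v1" "v2 \<noteq> r a v0" "v3 \<noteq> r a v0"
proof -
  have two: "u2 \<noteq> u0" if "hexagon u0 u1 u2 u3 u4 u5 a' b' c'" for u0 u1 u2 u3 u4 u5 a' b' c'
    using that r_eq_iff[of u1 a' c'] by (auto simp: hexagon_def)
  show "v2 \<noteq> v0" by (rule two[OF h])
  show "v4 \<noteq> v0" by (rule two[OF hexagon_flip[OF h]])
  show "v3 \<noteq> v1" by (rule two[OF hexagon_shift[OF h]])
  show "v3 \<noteq> r a v0" using h short1[of v0 a b c] by (auto simp: hexagon_def)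
  have v0: "v0 \<in> V" using h by (simp add: hexagon_def)
  have "side v2 = side v0" "side v3 = (\<not> side v0)" "side v4 = side v0" "side v1 = (\<not> side v0)"
    "side (r a v0) = (\<not> side v0)"
    using h by (auto simp: hexagon_def)
  then show "v3 \<noteq> v0" "v4 \<noteq> v1" "v2 \<noteq> r a v0" by auto
qed

end

section \<open>Sign patterns on a single hexagon\<close>

locale proper_hexagonal_net = hexagonal_net V r side q
  for V :: "'a set" and r side q +
  fixes s :: "'a \<Rightarrow> bool"
  assumes proper: "proper_signs s"
begin

abbreviation F :: "'a \<Rightarrow> colour \<Rightarrow> ('a \<times> 'a) set" where
  "F \<equiv> face_at s"

lemma F_inj: "v \<in> V \<Longrightarrow> F v i = F v j \<Longrightarrow> i = j"
  using proper by (auto simp: proper_signs_def dest: injD)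

lemma F_share:
  "v \<in> V \<Longrightarrow> x \<in> V \<Longrightarrow> distinct [i, j, k] \<Longrightarrow> F v i = F x i' \<Longrightarrow> F v j = F x j' \<Longrightarrow> x = v \<or> x = r k v"
  using proper unfolding proper_signs_def by blast

lemma face_cis:
  assumes "hexagon v0 v1 v2 v3 v4 v5 a b c" "s v0 = s v1"
  shows "F v0 a = F v1 b" "F v0 b = F v1 a"
  using assms face_at_cis[of v0 s c a b] face_at_cis[of v0 s c b a] by (auto simp: hexagon_def)

lemma face_trans:
  assumes "hexagon v0 v1 v2 v3 v4 v5 a b c" "s v0 \<noteq> s v1"
  shows "F v0 a = F v1 a" "F v0 b = F v1 b"
  using assms face_at_trans[of v0 s c a] face_at_trans[of v0 s c b] by (auto simp: hexagon_def)

context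
  fixes v0 v1 v2 v3 v4 v5 a b c
  assumes h0: "hexagon v0 v1 v2 v3 v4 v5 a b c"
begin

private lemmas h1 = hexagon_shift[OF h0]
private lemmas h2 = hexagon_shift[OF h1]
private lemmas h3 = hexagon_shift[OF h2]
private lemmas h4 = hexagon_shift[OF h3]
private lemmas h5 = hexagon_shift[OF h4]
private lemmas e = face_cis[OF h0] face_cis[OF h1] face_cis[OF h2] face_cis[OF h3] face_cis[OF h4] face_cis[OF h5]
  face_trans[OF h0] face_trans[OF h1] face_trans[OF h2] face_trans[OF h3] face_trans[OF h4] face_trans[OF h5]

private lemma abc: "distinct [a, b, c]" "distinct [b, c, a]" "distinct [a, c, b]"
  using h0 by (auto simp: hexagon_def)

private lemma v1: "v1 = r c v0"
  using h0 by (auto simp: hexagon_def)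

text \<open>The name lists the lengths of the cyclic runs of equal signs. Here one outer face would
  pass \<open>v1\<close> twice. In the four patterns that follow, two faces at \<open>v0\<close>
  meet again at a vertex that is not an end of their common edge.\<close>

lemma runs_1_5:
  assumes "s v0 = p" "s v1 = (\<not> p)" "s v2 = p" "s v3 = p" "s v4 = p" "s v5 = p"
  shows False
proof -
  have "F v1 a = F v1 c" using e assms by simp
  then show False using F_inj[OF hexagon_in(2)[OF h0]] abc by auto
qed

lemma runs_2_4:
  assumes "s v0 = p" "s v1 = (\<not> p)" "s v2 = (\<not> p)" "s v3 = p" "s v4 = p" "s v5 = p"
  shows False
proof -
  have "F v0 a = F v3 a" "F v0 b = F v3 c" using e assms by simp_all
  then show False
    using F_share[OF hexagon_in(1,4)[OF h0] abc(1)] hexagon_distinct[OF h0] v1 by blast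
qed

lemma runs_3_3:
  assumes "s v0 = p" "s v1 = (\<not> p)" "s v2 = (\<not> p)" "s v3 = (\<not> p)" "s v4 = p" "s v5 = p"
  shows False
proof -
  have "F v0 a = F v4 b" "F v0 b = F v4 a" using e assms by simp_all
  then show False
    using F_share[OF hexagon_in(1,5)[OF h0] abc(1)] hexagon_distinct[OF h0] v1 by blast
qed

lemma runs_1_1_1_3:
  assumes "s v0 = p" "s v1 = (\<not> p)" "s v2 = p" "s v3 = (\<not> p)" "s v4 = (\<not> p)" "s v5 = (\<not> p)"
  shows False
proof -
  have "F v0 b = F v2 b" "F v0 c = F v2 a" using e assms by simp_all
  then show False
    using F_share[OF hexagon_in(1,3)[OF h0] abc(2)] hexagon_distinct[OF h0] by blast
qed

lemma runs_1_2_1_2: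
  assumes "s v0 = p" "s v1 = (\<not> p)" "s v2 = (\<not> p)" "s v3 = p" "s v4 = (\<not> p)" "s v5 = (\<not> p)"
  shows False
proof -
  have "F v0 b = F v3 c" "F v0 c = F v3 b" using e assms by simp_all
  then show False
    using F_share[OF hexagon_in(1,4)[OF h0] abc(2)] hexagon_distinct[OF h0] by blast
qed

end

text \<open>All rotations of the five forbidden patterns are excluded. Besides constant signs, this
  leaves exactly one more edge with ends of equal sign, \<open>v2 v3\<close> or
  \<open>v4 v5\<close>.\<close>

lemma hexagon_signs:
  assumes h0: "hexagon v0 v1 v2 v3 v4 v5 a b c" and "s v0 = s v1"
  shows "s v2 = s v0 \<and> s v3 = s v0 \<and> s v4 = s v0 \<and> s v5 = s v0 \<or>
         s v2 \<noteq> s v0 \<and> s v3 \<noteq> s v0 \<and> s v4 = s v0 \<and> s v5 \<noteq> s v0 \<or>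
         s v2 \<noteq> s v0 \<and> s v3 = s v0 \<and> s v4 \<noteq> s v0 \<and> s v5 \<noteq> s v0"
proof -
  note h1 = hexagon_shift[OF h0]
  note h2 = hexagon_shift[OF h1]
  note h3 = hexagon_shift[OF h2]
  note h4 = hexagon_shift[OF h3]
  note h5 = hexagon_shift[OF h4]
  note * = h0 h1 h2 h3 h4 h5
  show ?thesis
    using *[THEN runs_1_5, OF refl] *[THEN runs_2_4, OF refl] *[THEN runs_3_3, OF refl]
      *[THEN runs_1_1_1_3, OF refl] *[THEN runs_1_2_1_2, OF refl] \<open>s v0 = s v1\<close>
    by (cases "s v0"; cases "s v2"; cases "s v3"; cases "s v4"; cases "s v5") simp_all
qed

section \<open>Uniform hexagons and their neighbours\<close>

text \<open>
  All signs agree on the hexagon through \<open>v\<close> that avoids the edge of colour \<open>a\<close>.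
\<close>

definition uniform :: "'a \<Rightarrow> colour \<Rightarrow> bool" where
  "uniform v a \<longleftrightarrow> (\<forall>b c. distinct [a, b, c] \<longrightarrow>
     s (r c v) = s v \<and> s (r a (r c v)) = s v \<and> s (r b (r a (r c v))) = s v)"

text \<open>The two admissible choices of \<open>b\<close> and \<open>c\<close> walk from
  \<open>v0\<close> in the two directions; both walks end at \<open>v3\<close>, so together they
  cover all six vertices.\<close>

lemma uniform_iff:
  assumes h: "hexagon v0 v1 v2 v3 v4 v5 a b c"
  shows "uniform v0 a \<longleftrightarrow> s v1 = s v0 \<and> s v2 = s v0 \<and> s v3 = s v0 \<and> s v4 = s v0 \<and> s v5 = s v0"
proof -
  have abc: "distinct [a, b, c]" using h by (simp add: hexagon_def)
  have "distinct [a, b', c'] \<longleftrightarrow> b' = b \<and> c' = c \<or> b' = c \<and> c' = b" for b' c'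
    using abc by (cases a; cases b; cases c; cases b'; cases c') auto
  then have "uniform v0 a \<longleftrightarrow> s v1 = s v0 \<and> s v2 = s v0 \<and> s v3 = s v0 \<and>
      s (r b v0) = s v0 \<and> s (r a (r b v0)) = s v0 \<and> s (r c (r a (r b v0))) = s v0"
    using h unfolding uniform_def hexagon_def by auto
  moreover have "r b v0 = v5" "r a (r b v0) = v4" "r c (r a (r b v0)) = v3"
    using hexagon_flip[OF h] by (simp_all add: hexagon_def)
  ultimately show ?thesis by auto
qed

lemma uniform_shift:
  assumes "hexagon v0 v1 v2 v3 v4 v5 a b c"
  shows "uniform v1 b \<longleftrightarrow> uniform v0 a"
  using uniform_iff[OF assms] uniform_iff[OF hexagon_shift[OF assms]] by auto

text \<open>The edge of colour \<open>c\<close> lies on the hexagon, and its two ends see different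
  outward colours of that same hexagon.\<close>

lemma uniform_step:
  assumes "v \<in> V" "distinct [a, b, c]"
  shows "uniform (r c v) b \<longleftrightarrow> uniform v a"
proof -
  obtain v1 v2 v3 v4 v5 where h: "hexagon v v1 v2 v3 v4 v5 a b c"
    using assms by (rule hexagonI)
  then have "v1 = r c v" by (simp add: hexagon_def)
  then show ?thesis using uniform_shift[OF h] by simp
qed

text \<open>The two given hexagons make \<open>v\<close> agree with both its neighbours on the third
  one, and no mixed pattern has three consecutive equal signs.\<close>

lemma uniform_third:
  assumes v: "v \<in> V" and abc: "distinct [a, b, c]" and uniform: "uniform v a" "uniform v b"
  shows "uniform v c"
proof -
  have "distinct [c, a, b]" using abc by auto
  with v obtain v1 v2 v3 v4 v5 where h: "hexagon v v1 v2 v3 v4 v5 c a b"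
    by (rule hexagonI)
  have "v1 = r b v" "v5 = r a v"
    using h hexagon_flip[OF h] by (auto simp: hexagon_def)
  moreover have "distinct [a, c, b]" "distinct [b, c, a]" using abc by auto
  then have "s (r b v) = s v" "s (r a v) = s v"
    using uniform unfolding uniform_def by blast+
  ultimately show ?thesis
    using hexagon_signs[OF h] by (simp add: uniform_iff[OF h])
qed

text \<open>Crossing an edge keeps the two hexagons along it, and \<open>uniform_third\<close>
  supplies the third; connectedness does the rest.\<close>

lemma uniform_spread:
  assumes v: "v \<in> V" "a \<noteq> b" "uniform v a" "uniform v b" and w: "w \<in> V"
  shows "uniform w k"
proof -
  have third: "\<forall>k. uniform u k" if u: "u \<in> V" "i \<noteq> j" "uniform u i" "uniform u j" for u i j
  proof -
    obtain l where l: "distinct [i, j, l]"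
      using u(2) by (cases i; cases j) (auto intro: that[of C0] that[of C1] that[of C2])
    show ?thesis
      using uniform_third[OF u(1) l u(3,4)] third_colour[OF l] u by metis
  qed
  have "\<forall>k. uniform w k"
  proof (rule V_induct[OF \<open>v \<in> V\<close> _ _ w])
    show "\<forall>k. uniform v k" using third v by blast
  next
    fix u c assume u: "u \<in> V" "\<forall>k. uniform u k"
    have d: "distinct [turn True c, turn False c, c]" "distinct [turn False c, turn True c, c]"
      by (cases c; simp)+
    have "uniform (r c u) (turn False c)" "uniform (r c u) (turn True c)"
      using uniform_step[OF u(1) d(1)] uniform_step[OF u(1) d(2)] u(2) by blast+
    moreover have "turn False c \<noteq> turn True c" using d(1) by simp
    ultimately show "\<forall>k. uniform (r c u) k"
      using third r_in[OF u(1)] by blast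
  qed
  then show ?thesis by blast
qed

text \<open>
  If the hexagon across \<open>v4 v5\<close> had mixed signs, then the faces that meet in \<open>v1\<close> and its
  neighbour outside the hexagon would meet again in \<open>x\<close> or \<open>y\<close>, on the far side of that hexagon.
\<close>

lemma uniform_across:
  assumes h0: "hexagon v0 v1 v2 v3 v4 v5 a b c"
    and s: "s v1 \<noteq> s v0" "s v2 = s v0" "s v3 = s v0" "s v4 \<noteq> s v0" "s v5 \<noteq> s v0"
  shows "uniform v5 b"
proof (rule ccontr)
  assume nT: "\<not> uniform v5 b"
  note h1 = hexagon_shift[OF h0]
  note h2 = hexagon_shift[OF h1]
  note h3 = hexagon_shift[OF h2]
  note h4 = hexagon_shift[OF h3]
  note h5 = hexagon_shift[OF h4]
  have in_V: "v0 \<in> V" "v1 \<in> V" "v5 \<in> V" using hexagon_in[OF h0] by auto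
  have abc: "distinct [a, b, c]" using h0 by (simp add: hexagon_def)
  then have "distinct [b, c, a]" by auto
  with \<open>v5 \<in> V\<close> obtain u4 w4 x y w5 where n0: "hexagon v5 u4 w4 x y w5 b c a"
    by (rule hexagonI)
  have "u4 = r a v5" "v4 = r a v5"
    using hexagon_flip[OF h5] n0 by (simp_all add: hexagon_def)
  then have "u4 = v4" by simp
  note n0 = n0[unfolded \<open>u4 = v4\<close>]
  note n1 = hexagon_shift[OF n0]
  note n2 = hexagon_shift[OF n1]
  note n3 = hexagon_shift[OF n2]
  note n4 = hexagon_shift[OF n3]
  note n5 = hexagon_shift[OF n4]
  have F1: "F v1 a = F w5 a" and F3: "F v1 c = F w4 a"
  proof -
    have *: "s w4 \<noteq> s v4" "s w5 \<noteq> s v5"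
      using hexagon_signs[OF n0] nT s unfolding uniform_iff[OF n0] by auto
    have "F v1 a = F v0 a" using face_trans[OF h0] s by simp
    also have "\<dots> = F v5 a" using face_trans[OF h5] s by simp
    also have "\<dots> = F w5 a" using face_trans[OF n5] * by simp
    finally show "F v1 a = F w5 a" .
    have "F v1 c = F v2 c" using face_trans[OF h1] s by simp
    also have "\<dots> = F v3 a" using face_cis[OF h2] s by simp
    also have "\<dots> = F v4 a" using face_trans[OF h3] s by simp
    also have "\<dots> = F w4 a" using face_trans[OF n1] * by simp
    finally show "F v1 c = F w4 a" .
  qed
  have "distinct [a, c, b]" using abc by auto
  \<comment> \<open>The two faces share the edge of colour \<open>b\<close> at \<open>v1\<close>, so
    any other common vertex is \<open>r b v1\<close>.\<close>
  note share = F_share[OF \<open>v1 \<in> V\<close> _ this]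
  have y: "y = r b (r c (r b v0))"
  proof -
    have "y = r b w5" "w5 = r c v5" "v5 = r b v0"
      using hexagon_flip[OF n0] hexagon_flip[OF h0] by (auto simp: hexagon_def)
    then show ?thesis by simp
  qed
  have x: "x = r a y" using hexagon_flip[OF n0] by (simp add: hexagon_def)
  have v1: "v1 = r c v0" using h0 by (simp add: hexagon_def)
  \<comment> \<open>The two mixed patterns of the neighbouring hexagon make the faces meet at
    \<open>y\<close> or at \<open>x\<close>. Each time \<open>side\<close> excludes one end of the
    shared edge and a \<open>short\<close> condition the other.\<close>
  consider "s w4 = s x" "s x \<noteq> s y" "s y \<noteq> s w5" | "s w4 \<noteq> s x" "s x \<noteq> s y" "s y = s w5"
    using hexagon_signs[OF n0] nT s unfolding uniform_iff[OF n0] by auto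
  then show False
  proof cases
    case 1
    have "F w5 a = F y a" using face_trans[OF n4] 1 by simp
    moreover have "F w4 a = F y b" using face_cis[OF n2] face_trans[OF n3] 1 by simp
    ultimately have "y = v1 \<or> y = r b v1"
      using share[of y a b] F1 F3 hexagon_in[OF n0] by simp
    moreover have "y \<noteq> v1" using short2[OF in_V(1) abc] y v1 by simp
    moreover have "side y = side v1" using y v1 in_V by simp
    ultimately show False using in_V side_r[of v1 b] by auto
  next
    case 2
    have "F w5 a = F x c" using face_cis[OF n4] face_trans[OF n3] 2 by simp
    moreover have "F w4 a = F x a" using face_trans[OF n2] 2 by simp
    ultimately have "x = v1 \<or> x = r b v1"
      using share[of x c a] F1 F3 hexagon_in[OF n0] by simp
    moreover have "x \<noteq> r b v1" using short3[OF in_V(1) abc] x y v1 by simp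
    moreover have "side x \<noteq> side v1" using x y v1 in_V by simp
    ultimately show False by auto
  qed
qed

text \<open>The reflection exchanging \<open>v0\<close> and \<open>v1\<close> interchanges the two
  mixed patterns, so one suffices. The uniform hexagon lies across the second edge with equal signs;
  the inequality records which pattern occurs.\<close>

lemma mixed_hexagon:
  assumes h: "hexagon v0 v1 v2 v3 v4 v5 a b c" and cis: "s v0 = s v1" and nT: "\<not> uniform v0 a"
  shows "uniform v2 a \<and> s v4 \<noteq> s v5 \<or> uniform v5 b \<and> s v2 \<noteq> s v3"
proof -
  have *: "uniform u2 a' \<and> s u4 \<noteq> s u5"
    if h0: "hexagon u0 u1 u2 u3 u4 u5 a' b' c'"
      and s: "s u1 = s u0" "s u2 \<noteq> s u0" "s u3 \<noteq> s u0" "s u4 = s u0" "s u5 \<noteq> s u0"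
    for u0 u1 u2 u3 u4 u5 a' b' c'
  proof -
    note h1 = hexagon_shift[OF h0]
    note h2 = hexagon_shift[OF h1]
    note h3 = hexagon_shift[OF h2]
    note h4 = hexagon_shift[OF h3]
    have "uniform u3 c'" by (rule uniform_across[OF h4]) (simp_all add: s)
    moreover have "u3 = r b' u2" "distinct [a', c', b']"
      using h0 by (auto simp: hexagon_def)
    ultimately have "uniform u2 a'"
      using uniform_step[OF hexagon_in(3)[OF h0], of a' c' b'] by blast
    then show ?thesis using s by simp
  qed
  show ?thesis
    using hexagon_signs[OF h cis] nT cis *[OF h] *[OF hexagon_flip[OF hexagon_shift[OF h]]]
    unfolding uniform_iff[OF h] by auto
qed

text \<open>The other hexagon at the edge from \<open>v\<close> to \<open>r c v\<close> is mixed, so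
  it has a uniform neighbour across its second edge with equal signs. Uniformity across an edge
  forces equal signs on it, so exactly one of the two candidates is uniform.\<close>

lemma uniform_exchange:
  assumes v: "v \<in> V" and abc: "distinct [a, b, c]" and uniform: "uniform v a" "\<not> uniform v b"
  shows "uniform (r b (r c v)) b \<longleftrightarrow> \<not> uniform (r a v) a"
proof -
  have in_V: "r c v \<in> V" using v by simp
  obtain v1 w0 x y w1 where n: "hexagon (r c v) v1 w0 x y w1 a b c"
    using in_V abc by (rule hexagonI)
  have e: "v1 = v" "w0 = r a v" "x = r b w0"
    using n v by (simp_all add: hexagon_def)
  have e': "w1 = r b (r c v)" "y = r a w1"
    using hexagon_flip[OF n] by (simp_all add: hexagon_def)
  have "s v = s (r c v)" using uniform(1) abc unfolding uniform_def by blast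
  moreover have "\<not> uniform (r c v) a"
  proof -
    have "distinct [b, a, c]" using abc by auto
    then show ?thesis using uniform_step[OF v] uniform(2) by blast
  qed
  ultimately have "uniform w0 a \<and> s y \<noteq> s w1 \<or> uniform w1 b \<and> s w0 \<noteq> s x"
    using mixed_hexagon[OF n] e(1) by simp
  moreover have "s x = s w0" if "uniform w0 a"
    using that abc unfolding uniform_def e(3) by auto
  moreover have "s y = s w1" if "uniform w1 b"
    using that abc unfolding uniform_def e'(2) by auto
  ultimately show ?thesis unfolding e(2)[symmetric] e'(1)[symmetric] by auto
qed

text \<open>An edge with equal signs would lie on a mixed hexagon, which has a uniform
  neighbour.\<close>

lemma no_uniform_imp_alternating:
  assumes "\<And>v k. v \<in> V \<Longrightarrow> \<not> uniform v k" and "v \<in> V"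
  shows "s (r c v) \<noteq> s v"
proof
  assume cis: "s (r c v) = s v"
  have "distinct [turn True c, turn False c, c]" by (cases c) auto
  with \<open>v \<in> V\<close> obtain v1 v2 v3 v4 v5
    where h: "hexagon v v1 v2 v3 v4 v5 (turn True c) (turn False c) c"
    by (rule hexagonI)
  then have "s v = s v1" using cis by (simp add: hexagon_def)
  then show False
    using mixed_hexagon[OF h] assms(1) hexagon_in[OF h] by blast
qed

text \<open>
  If no two hexagons satisfying \<open>uniform\<close> are adjacent, they form a honeycomb of period 3, which is
  incompatible with the period \<open>3 q + 1\<close> of the net.
\<close>

context
  assumes not_adjacent: "\<And>v i j. v \<in> V \<Longrightarrow> uniform v i \<Longrightarrow> uniform v j \<Longrightarrow> i = j"
begin

text \<open>Each use of \<open>uniform_exchange\<close> at the next vertex flips whether the outward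
  edge leads to a uniform hexagon, so after two steps it does again.\<close>

private lemma uniform_next:
  assumes v: "v \<in> V" and abc: "distinct [a, b, c]" and uniform: "uniform v a" "uniform (r a v) a"
  shows "uniform (r a (r c v)) c \<and> uniform (r c (r a (r c v))) c"
proof -
  have "\<not> uniform v b" using not_adjacent[OF v uniform(1)] abc by auto
  then have "\<not> uniform (r b (r c v)) b" using uniform_exchange[OF v abc uniform(1)] uniform(2) by blast
  moreover have T1: "uniform (r c v) b" using uniform_step[OF v abc] uniform(1) by blast
  moreover have in_V: "r c v \<in> V" using v by simp
  moreover have bca: "distinct [b, c, a]" using abc by auto
  moreover have "\<not> uniform (r c v) c" using not_adjacent[OF in_V T1] abc by auto
  ultimately have "uniform (r c (r a (r c v))) c" using uniform_exchange[OF in_V bca] by blast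
  then show ?thesis using uniform_step[OF in_V bca] T1 by blast
qed

text \<open>Cross the outward edge and apply \<open>uniform_next\<close>, then do the same with
  \<open>a\<close> and \<open>c\<close> exchanged: together these moves are three steps of the
  translation.\<close>

lemma uniform_translate:
  assumes v: "v \<in> V" and abc: "distinct [a, b, c]" and uniform: "uniform v a" "uniform (r a v) a"
  shows "((\<lambda>v. r c (r a v)) ^^ (3 * n)) v \<in> V \<and> uniform (((\<lambda>v. r c (r a v)) ^^ (3 * n)) v) a
    \<and> uniform (r a (((\<lambda>v. r c (r a v)) ^^ (3 * n)) v)) a"
proof (induction n)
  case 0
  then show ?case using v uniform by simp
next
  case (Suc n)
  define u where "u = ((\<lambda>v. r c (r a v)) ^^ (3 * n)) v"
  have u: "u \<in> V" "uniform u a" "uniform (r a u) a" using Suc by (auto simp: u_def)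
  define y where "y = r a (r c (r a u))"
  have y: "y \<in> V" "uniform y c" "uniform (r c y) c"
    using uniform_next[OF _ abc, of "r a u"] u by (auto simp: y_def)
  define z where "z = r c (r a (r c y))"
  have cba: "distinct [c, b, a]" using abc by auto
  have z: "z \<in> V" "uniform z a" "uniform (r a z) a"
    using uniform_next[OF _ cba, of "r c y"] y by (auto simp: z_def)
  have "((\<lambda>v. r c (r a v)) ^^ (3 * Suc n)) v = z"
    by (simp add: z_def y_def u_def numeral_3_eq_3 funpow_swap1)
  then show ?case using z by simp
qed

lemma not_adjacent_imp_no_uniform:
  assumes v: "v \<in> V"
  shows "\<not> uniform v a"
proof
  assume uniform: "uniform v a"
  have False if v: "v \<in> V" and uniform: "uniform v a" "uniform (r a v) a" for v a
  proof -
    obtain b c where abc: "distinct [a, b, c]"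
      by (cases a) (auto intro: that[of C1 C2] that[of C2 C0] that[of C0 C1])
    define f where "f = (\<lambda>v. r c (r a v))"
    \<comment> \<open>\<open>3 * q\<close> steps stop one short of the period, so \<open>u\<close>
      is the predecessor of \<open>v\<close> under \<open>f\<close>. There
      \<open>uniform_translate\<close> and \<open>uniform_next\<close> give two different uniform
      colours.\<close>
    define u where "u = (f ^^ (3 * q)) v"
    have u: "u \<in> V" "uniform u a"
      using uniform_translate[OF v abc uniform, of q] by (auto simp: u_def f_def)
    have "f u = v"
      using period[OF v, of a c] abc by (simp add: u_def f_def)
    then have "u = r a (r c v)" using u by (auto simp: f_def)
    then have "uniform u c" using uniform_next[OF v abc uniform] by simp
    then show False using not_adjacent[OF u] abc by auto
  qed
  moreover obtain b c where abc: "distinct [a, b, c]"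
    by (cases a) (auto intro: that[of C1 C2] that[of C2 C0] that[of C0 C1])
  moreover have "\<not> uniform v b" using not_adjacent[OF v uniform] abc by auto
  moreover have "uniform (r c v) b" using uniform_step[OF v abc] uniform by blast
  \<comment> \<open>Either \<open>v\<close> with colour \<open>a\<close> or \<open>r c v\<close>
    with colour \<open>b\<close> meets the hypotheses just refuted.\<close>
  ultimately show False using uniform_exchange[OF v abc uniform] v uniform r_in by metis
qed

end

theorem constant_or_alternating:
  "(\<forall>v\<in>V. \<forall>k. s (r k v) = s v) \<or> (\<forall>v\<in>V. \<forall>k. s (r k v) \<noteq> s v)"
proof (cases "\<exists>v\<in>V. \<exists>i j. i \<noteq> j \<and> uniform v i \<and> uniform v j")
  case True
  then have uniform: "uniform w k" if "w \<in> V" for w k using uniform_spread that by blast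
  have "s (r k w) = s w" if "w \<in> V" for w k
  proof -
    have "distinct [turn True k, turn False k, k]" by (cases k) auto
    then show ?thesis using uniform[OF that, of "turn True k"] unfolding uniform_def by blast
  qed
  then show ?thesis by blast
next
  case False
  then have "\<not> uniform v k" if "v \<in> V" for v k
    using not_adjacent_imp_no_uniform that by metis
  then show ?thesis using no_uniform_imp_alternating by blast
qed

end

section \<open>The hexagonal torus and its Petrie dual\<close>

fun ax :: "colour \<Rightarrow> int" where
  "ax C0 = 0" | "ax C1 = 1" | "ax C2 = 0"

fun ay :: "colour \<Rightarrow> int" where
  "ay C0 = 0" | "ay C1 = 0" | "ay C2 = 1"

locale hexagonal_torus =
  fixes q :: nat
  assumes q_pos: "1 \<le> q"
begin

definition m :: int where
  "m = 3 * int q + 1"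

lemma m_gt: "3 < m"
  using q_pos by (simp add: m_def)

lemma not_m_dvd: "0 < \<bar>x\<bar> \<Longrightarrow> \<bar>x\<bar> < m \<Longrightarrow> \<not> m dvd x"
  using zdvd_not_zless[of "\<bar>x\<bar>" m] by simp

lemma not_m_dvd_small [simp]: "\<not> m dvd 2" "\<not> m dvd 3" "m \<noteq> 1" "\<bar>m\<bar> = m"
  using m_gt not_m_dvd[of 2] not_m_dvd[of 3] by auto

text \<open>
  The vertex \<open>\<phi> i j False\<close> is joined along colours \<open>C0\<close>, \<open>C1\<close>, \<open>C2\<close> to
  \<open>\<phi> i j True\<close>, \<open>\<phi> (i - 1) j True\<close>, \<open>\<phi> i (j - 1) True\<close>.
\<close>

definition \<phi> :: "int \<Rightarrow> int \<Rightarrow> bool \<Rightarrow> nat" where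
  "\<phi> i j t = to_nat (i mod m, j mod m, t)"

definition V :: "nat set" where
  "V = {\<phi> i j t | i j t. True}"

definition side :: "nat \<Rightarrow> bool" where
  "side v = snd (snd (from_nat v :: int \<times> int \<times> bool))"

definition r :: "colour \<Rightarrow> nat \<Rightarrow> nat" where
  "r k v = (case from_nat v of (i, j, t) \<Rightarrow>
     if t then \<phi> (i + ax k) (j + ay k) False else \<phi> (i - ax k) (j - ay k) True)"

lemma \<phi>_eq_iff: "\<phi> i j t = \<phi> i' j' t' \<longleftrightarrow> m dvd i - i' \<and> m dvd j - j' \<and> t = t'"
  by (simp add: \<phi>_def mod_eq_dvd_iff)

lemma \<phi>_mod [simp]: "\<phi> (i mod m) j t = \<phi> i j t" "\<phi> i (j mod m) t = \<phi> i j t"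
  by (simp_all add: \<phi>_def)

lemma side_\<phi> [simp]: "side (\<phi> i j t) = t"
  by (simp add: side_def \<phi>_def)

lemma r_\<phi> [simp]:
  "r k (\<phi> i j True) = \<phi> (i + ax k) (j + ay k) False"
  "r k (\<phi> i j False) = \<phi> (i - ax k) (j - ay k) True"
  by (simp_all add: r_def \<phi>_def mod_simps)

lemma \<phi>_in [simp]: "\<phi> i j t \<in> V"
  by (auto simp: V_def)

lemma VE:
  assumes "v \<in> V"
  obtains i j t where "v = \<phi> i j t"
  using assms by (auto simp: V_def)

lemma V_eq: "V = (\<lambda>(i, j, t). \<phi> i j t) ` ({0..<m} \<times> {0..<m} \<times> UNIV)"
proof -
  have "\<phi> i j t \<in> (\<lambda>(i, j, t). \<phi> i j t) ` ({0..<m} \<times> {0..<m} \<times> UNIV)" for i j t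
    using m_gt by (intro image_eqI[of _ _ "(i mod m, j mod m, t)"]) auto
  then show ?thesis by (auto simp: V_def)
qed

lemma \<phi>_inj:
  "\<phi> i j t = \<phi> i' j' t' \<Longrightarrow> i \<in> {0..<m} \<Longrightarrow> i' \<in> {0..<m} \<Longrightarrow> j \<in> {0..<m} \<Longrightarrow> j' \<in> {0..<m} \<Longrightarrow>
    i = i' \<and> j = j' \<and> t = t'"
  by (simp add: \<phi>_def)

lemma card_V: "int (card V) = 2 * m\<^sup>2"
proof -
  have "inj_on (\<lambda>(i, j, t). \<phi> i j t) ({0..<m} \<times> {0..<m} \<times> UNIV)"
    by (rule inj_onI) (auto dest!: \<phi>_inj)
  then have "card V = card ({0..<m} \<times> {0..<m} \<times> (UNIV :: bool set))"
    unfolding V_eq by (rule card_image)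
  then show ?thesis
    using m_gt by (simp add: card_cartesian_product power2_eq_square)
qed

text \<open>Combining \<open>C0\<close> with \<open>C1\<close> or \<open>C2\<close> moves by one
  unit in one coordinate, and \<open>C0\<close> alone changes the side, so every vertex is
  reached.\<close>

lemma torus_induct:
  assumes "P (\<phi> i j t)" and step: "\<And>v k. v \<in> V \<Longrightarrow> P v \<Longrightarrow> P (r k v)"
  shows "P (\<phi> i' j' t')"
proof -
  have flip: "P (\<phi> i j (\<not> t))" if "P (\<phi> i j t)" for i j t
    using step[OF \<phi>_in that, of C0] by (cases t) auto
  have B: "P (\<phi> i j False)" for i j
  proof -
    have right: "P (\<phi> (i + 1) j False)" if "P (\<phi> i j False)" for i j
      using step[OF \<phi>_in step[OF \<phi>_in that, of C0, simplified], of C1] by simp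
    have left: "P (\<phi> (i - 1) j False)" if "P (\<phi> i j False)" for i j
      using step[OF \<phi>_in step[OF \<phi>_in that, of C1, simplified], of C0] by simp
    have up: "P (\<phi> i (j + 1) False)" if "P (\<phi> i j False)" for i j
      using step[OF \<phi>_in step[OF \<phi>_in that, of C0, simplified], of C2] by simp
    have down: "P (\<phi> i (j - 1) False)" if "P (\<phi> i j False)" for i j
      using step[OF \<phi>_in step[OF \<phi>_in that, of C2, simplified], of C0] by simp
    have start: "P (\<phi> i0 j0 False)" if "i0 = i1" "j0 = j1" "P (\<phi> i1 j1 t)" for i0 j0 i1 j1 t
      using that flip[of i1 j1 t] by (cases t) auto
    obtain i0 j0 where 0: "P (\<phi> i0 j0 False)" using assms(1) start by blast
    have "P (\<phi> i j0 False)"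
      by (induction i rule: int_induct[of _ i0]) (use 0 left right in auto)
    then show ?thesis
      by (induction j rule: int_induct[of _ j0]) (use up down in auto)
  qed
  show ?thesis using B[of i' j'] flip[OF B] by (cases t') auto
qed

sublocale net: hexagonal_net V r side q
proof
  show "finite V" unfolding V_eq by (intro finite_imageI finite_cartesian_product) auto
  show "V \<noteq> {}" using \<phi>_in by blast
  show "P v" if "u \<in> V" "P u" "\<And>v k. v \<in> V \<Longrightarrow> P v \<Longrightarrow> P (r k v)" "v \<in> V" for P u v
    using that torus_induct[of P] by (metis VE)
next
  fix v :: nat assume v: "v \<in> V"
  then obtain i j t where [simp]: "v = \<phi> i j t" by (rule VE)
  show "r k v \<in> V" for k by (cases t) auto
  show "r k (r k v) = v" for k by (cases t) auto
  show "r k v \<noteq> v" for k by (cases t) (auto simp: \<phi>_eq_iff)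
  show "r k v = r l v \<longleftrightarrow> k = l" for k l
    by (cases t; cases k; cases l) (simp_all add: \<phi>_eq_iff)
  show "side (r k v) \<longleftrightarrow> \<not> side v" for k by (cases t) auto
next
  fix v :: nat and a b c assume v: "v \<in> V" and abc: "distinct [a, b, c :: colour]"
  then obtain i j t where [simp]: "v = \<phi> i j t" by (auto elim: VE)
  show "r b (r a (r c (r b (r a (r c v))))) = v"
    by (cases t) (simp_all add: \<phi>_eq_iff)
  \<comment> \<open>In coordinates this and the next two claims say that \<open>m\<close> fails to
    divide some nonzero integer of absolute value at most 3.\<close>
  show "r b (r a (r c v)) \<noteq> r a v"
    using abc by (cases t; cases a; cases b; cases c) (simp_all add: \<phi>_eq_iff)
  show "r b (r c (r b v)) \<noteq> r c v"
    using abc by (cases t; cases a; cases b; cases c) (simp_all add: \<phi>_eq_iff)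
  show "r a (r b (r c (r b v))) \<noteq> r b (r c v)"
    using abc by (cases t; cases a; cases b; cases c) (simp_all add: \<phi>_eq_iff)
next
  fix v :: nat and a c :: colour assume v: "v \<in> V"
  then obtain i j t where [simp]: "v = \<phi> i j t" by (rule VE)
  \<comment> \<open>Alternating two colours translates by a fixed vector, whose sign depends on the
    side; after \<open>m\<close> rounds the displacement vanishes modulo \<open>m\<close>.\<close>
  define d where "d = (if t then -1 else 1 :: int)"
  have "((\<lambda>v. r c (r a v)) ^^ n) v = \<phi> (i + int n * (d * (ax c - ax a))) (j + int n * (d * (ay c - ay a))) t" for n
  proof (induction n)
    case (Suc n)
    then show ?case by (cases t) (simp_all add: d_def algebra_simps)
  qed simp
  moreover have "int (3 * q + 1) = m" by (simp add: m_def)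
  ultimately show "((\<lambda>v. r c (r a v)) ^^ (3 * q + 1)) v = v"
    by (simp only: \<open>v = \<phi> i j t\<close> \<phi>_eq_iff) simp
qed

section \<open>Edge count and the embedding with hexagonal faces\<close>

abbreviation face :: "(nat \<Rightarrow> bool) \<Rightarrow> nat \<Rightarrow> colour \<Rightarrow> (nat \<times> nat) set" where
  "face \<equiv> net.face_at"

lemma card_edges: "int (card (undirected_edges (parcs net.G))) = 3 * m\<^sup>2"
proof -
  let ?S = "{0..<m} \<times> {0..<m} \<times> (UNIV :: colour set)"
  \<comment> \<open>Listing each edge from its end on the side \<open>False\<close> avoids counting
    it twice.\<close>
  let ?e = "\<lambda>(i, j, k). {\<phi> i j False, r k (\<phi> i j False)}"
  have "undirected_edges (parcs net.G) = ?e ` ?S"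
  proof (intro equalityI subsetI)
    fix e assume "e \<in> undirected_edges (parcs net.G)"
    then obtain v k where v: "v \<in> V" "e = {v, r k v}"
      by (auto simp: undirected_edges_def net.parcs_G)
    have "\<exists>i j. e = {\<phi> i j False, r k (\<phi> i j False)}"
    proof -
      obtain i j t where ijt: "v = \<phi> i j t" using v(1) by (rule VE)
      show ?thesis
      proof (cases t)
        case True
        then have "e = {\<phi> (i + ax k) (j + ay k) False, r k (\<phi> (i + ax k) (j + ay k) False)}"
          using v ijt by auto
        then show ?thesis by blast
      next
        case False
        then show ?thesis using v ijt by auto
      qed
    qed
    then obtain i j where e: "e = {\<phi> i j False, r k (\<phi> i j False)}" by blast
    then have "e = ?e (i mod m, j mod m, k)" by (simp add: \<phi>_eq_iff mod_simps) (simp add: \<phi>_def mod_simps)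
    then show "e \<in> ?e ` ?S" using m_gt by (intro image_eqI[of _ _ "(i mod m, j mod m, k)"]) auto
  next
    fix e assume "e \<in> ?e ` ?S"
    then obtain i j k where "e = (\<lambda>(u, v). {u, v}) (\<phi> i j False, r k (\<phi> i j False))" by auto
    then show "e \<in> undirected_edges (parcs net.G)"
      unfolding undirected_edges_def using net.arc_G[of "\<phi> i j False" k] by (intro image_eqI) auto
  qed
  moreover have "inj_on ?e ?S"
  proof (rule inj_onI)
    fix x y assume *: "x \<in> ?S" "y \<in> ?S" "?e x = ?e y"
    obtain i j k i' j' k' where xy: "x = (i, j, k)" "y = (i', j', k')"
      by (cases x; cases y)
    have "\<phi> i j False = \<phi> i' j' False \<and> r k (\<phi> i j False) = r k' (\<phi> i' j' False)"
      using *(3) unfolding xy prod.case doubleton_eq_iff by (auto simp: \<phi>_eq_iff)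
    then show "x = y"
      using \<phi>_inj[of i j False i' j' False] * net.r_eq_iff[of "\<phi> i j False" k k']
      unfolding xy by auto
  qed
  ultimately have "card (undirected_edges (parcs net.G)) = card ?S"
    by (simp add: card_image)
  then show ?thesis
    using m_gt by (simp add: card_cartesian_product UNIV_colour power2_eq_square)
qed

text \<open>Serves to eliminate unknown coordinates: equal labels express one vertex relative to
  another.\<close>

lemma \<phi>_shift:
  assumes "\<phi> (i + a) (j + b) u = \<phi> (i' + a') (j' + b') u"
  shows "\<phi> i' j' t = \<phi> (i + (a - a')) (j + (b - b')) t"
proof -
  have "m dvd (i' + a') - (i + a)" "m dvd (j' + b') - (j + b)"
    using assms[symmetric] by (auto simp: \<phi>_eq_iff)
  then show ?thesis by (simp add: \<phi>_eq_iff algebra_simps)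
qed

text \<open>
  A hexagon of the torus is labelled by its vertex of the form \<open>\<phi> i j False\<close> at which it avoids \<open>C0\<close>.
\<close>

definition hex_label :: "nat \<Rightarrow> colour \<Rightarrow> nat" where
  "hex_label v k = (case from_nat v of (i, j, t) \<Rightarrow>
     if t then \<phi> (i + (1 - ax k)) (j + (1 - ay k)) False else \<phi> (i + ax k) (j + ay k) False)"

lemma hex_label_\<phi>:
  "hex_label (\<phi> i j t) k =
     \<phi> (i + (if t then 1 - ax k else ax k)) (j + (if t then 1 - ay k else ay k)) False"
  by (simp add: hex_label_def \<phi>_def mod_simps)

lemma hex_label_face:
  assumes "v \<in> V" "w \<in> V" "face (\<lambda>_. True) w l = face (\<lambda>_. True) v k"
  shows "hex_label w l = hex_label v k"
proof (rule net.face_at_constant[OF _ assms])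
  fix v c assume "v \<in> V"
  then obtain i j t where "v = \<phi> i j t" by (rule VE)
  then show "hex_label (r c v) (turn (\<not> True) c) = hex_label v (turn True c)"
    by (cases t; cases c) (simp_all add: hex_label_\<phi>)
qed

lemma proper_signs_torus: "net.proper_signs (\<lambda>_. True)"
  unfolding net.proper_signs_def
proof (intro conjI ballI allI impI)
  fix v assume v: "v \<in> V"
  then obtain i j t where ijt: "v = \<phi> i j t" by (rule VE)
  show "inj (face (\<lambda>_. True) v)"
  proof (rule injI)
    fix k l assume "face (\<lambda>_. True) v k = face (\<lambda>_. True) v l"
    then have "hex_label v k = hex_label v l" using hex_label_face v by blast
    then show "k = l"
      by (cases t; cases k; cases l) (simp_all add: ijt hex_label_\<phi> \<phi>_eq_iff)
  qed
next
  fix v x i j k i' j'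
  assume v: "v \<in> V" and x: "x \<in> V" and ijk: "distinct [i, j, k :: colour]"
    and i: "face (\<lambda>_. True) v i = face (\<lambda>_. True) x i'" and j: "face (\<lambda>_. True) v j = face (\<lambda>_. True) x j'"
  obtain p1 p2 t where v_eq: "v = \<phi> p1 p2 t" using v by (rule VE)
  obtain x1 x2 u where x_eq: "x = \<phi> x1 x2 u" using x by (rule VE)
  have eq_i: "hex_label v i = hex_label x i'" using hex_label_face[OF x v i] .
  have eq_j: "hex_label v j = hex_label x j'" using hex_label_face[OF x v j] .
  define h1 where "h1 = (\<lambda>t k. if t then 1 - ax k else ax k)"
  define h2 where "h2 = (\<lambda>t k. if t then 1 - ay k else ay k)"
  \<comment> \<open>With \<open>x\<close> expressed relative to \<open>v\<close>, the coordinates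
    cancel, and only congruences between constants remain for each choice of colours and
    sides.\<close>
  have x': "x = \<phi> (p1 + (h1 t i - h1 u i')) (p2 + (h2 t i - h2 u i')) u"
    unfolding x_eq h1_def h2_def
    by (rule \<phi>_shift) (use eq_i in \<open>simp only: v_eq x_eq hex_label_\<phi>\<close>)
  have "\<phi> (p1 + h1 t j) (p2 + h2 t j) False =
      \<phi> (p1 + (h1 t i - h1 u i') + h1 u j') (p2 + (h2 t i - h2 u i') + h2 u j') False"
    using eq_j unfolding v_eq x' hex_label_\<phi> h1_def h2_def .
  then show "x = v \<or> x = r k v"
    using ijk unfolding x' v_eq h1_def h2_def
    by (cases t; cases u; cases i; cases j; cases k; cases i'; cases j') (simp_all add: \<phi>_eq_iff)
qed

text \<open>Every corner can be moved along its face to one on the side \<open>False\<close> that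
  avoids \<open>C0\<close>. With \<open>hex_label_face\<close> this makes faces correspond to
  labels.\<close>

lemma face_torus_label:
  assumes "v \<in> V"
  shows "face (\<lambda>_. True) v k = face (\<lambda>_. True) (hex_label v k) C0"
proof -
  have *: "face (\<lambda>_. True) v k = face (\<lambda>_. True) (r c v) l" if "v \<in> V" "distinct [c, k, l]" for v c k l
    using net.face_at_cis[OF that(1) _ that(2), of "\<lambda>_. True"] by simp
  have W1: "face (\<lambda>_. True) (\<phi> i j True) C1 = face (\<lambda>_. True) (\<phi> i (j + 1) False) C0" for i j
    using *[of "\<phi> i j True" C2 C1 C0] by simp
  have W2: "face (\<lambda>_. True) (\<phi> i j True) C2 = face (\<lambda>_. True) (\<phi> (i + 1) j False) C0" for i j
    using *[of "\<phi> i j True" C1 C2 C0] by simp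
  have B1: "face (\<lambda>_. True) (\<phi> i j False) C1 = face (\<lambda>_. True) (\<phi> (i + 1) j False) C0" for i j
    using *[of "\<phi> i j False" C0 C1 C2] W2 by simp
  have B2: "face (\<lambda>_. True) (\<phi> i j False) C2 = face (\<lambda>_. True) (\<phi> i (j + 1) False) C0" for i j
    using *[of "\<phi> i j False" C0 C2 C1] W1 by simp
  have W0: "face (\<lambda>_. True) (\<phi> i j True) C0 = face (\<lambda>_. True) (\<phi> (i + 1) (j + 1) False) C0" for i j
    using *[of "\<phi> i j True" C1 C0 C2] B2 by simp
  obtain i j t where "v = \<phi> i j t" using assms by (rule VE)
  then show ?thesis
    by (cases t; cases k) (simp_all add: hex_label_\<phi> W0 W1 W2 B1 B2)
qed

lemma card_faces_torus: "int (card (faces net.G (net.rot (\<lambda>_. True)))) = m\<^sup>2"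
proof -
  let ?f = "\<lambda>(i, j). face (\<lambda>_. True) (\<phi> i j False) C0"
  have lab: "hex_label (\<phi> i j False) C0 = \<phi> i j False" for i j
    by (simp add: hex_label_\<phi>)
  have "faces net.G (net.rot (\<lambda>_. True)) = ?f ` ({0..<m} \<times> {0..<m})"
  proof (intro equalityI subsetI)
    fix f assume "f \<in> faces net.G (net.rot (\<lambda>_. True))"
    then obtain v k where v: "v \<in> V" "f = face (\<lambda>_. True) v k" by (auto simp: net.faces_eq)
    obtain i j t where "v = \<phi> i j t" using v(1) by (rule VE)
    then obtain i' j' where "hex_label v k = \<phi> i' j' False" by (auto simp: hex_label_\<phi>)
    then have "f = ?f (i' mod m, j' mod m)"
      using v face_torus_label[of v k] by simp
    then show "f \<in> ?f ` ({0..<m} \<times> {0..<m})"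
      using m_gt by (intro image_eqI[of _ _ "(i' mod m, j' mod m)"]) auto
  qed (auto simp: net.faces_eq)
  moreover have "inj_on ?f ({0..<m} \<times> {0..<m})"
  proof (rule inj_onI)
    fix x y assume *: "x \<in> {0..<m} \<times> {0..<m}" "y \<in> {0..<m} \<times> {0..<m}" "?f x = ?f y"
    obtain i j i' j' where xy: "x = (i, j)" "y = (i', j')" by (cases x; cases y)
    have "hex_label (\<phi> i j False) C0 = hex_label (\<phi> i' j' False) C0"
      using *(3) by (intro hex_label_face) (simp_all add: xy)
    then show "x = y" using \<phi>_inj[of i j False i' j' False] * by (auto simp: lab xy)
  qed
  ultimately have "card (faces net.G (net.rot (\<lambda>_. True))) = card ({0..<m} \<times> {0..<m})"
    by (simp add: card_image)
  then show ?thesis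
    using m_gt by (simp add: card_cartesian_product power2_eq_square)
qed

section \<open>Zigzags and the Petrie dual\<close>

text \<open>
  The faces for \<open>side\<close> are the zigzags: the one at \<open>v\<close> avoiding \<open>k\<close> uses only the other two colours,
  and is labelled by its intersection with a coordinate axis.
\<close>

definition zigzag_label :: "nat \<Rightarrow> colour \<Rightarrow> nat" where
  "zigzag_label v k = (case from_nat v of (i, j, t) \<Rightarrow>
     (case k of C0 \<Rightarrow> \<phi> (i + j + of_bool t) 0 False | C1 \<Rightarrow> \<phi> i 0 False | C2 \<Rightarrow> \<phi> 0 j False))"

lemma zigzag_label_\<phi> [simp]:
  "zigzag_label (\<phi> i j t) C0 = \<phi> (i + j + of_bool t) 0 False"
  "zigzag_label (\<phi> i j t) C1 = \<phi> i 0 False"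
  "zigzag_label (\<phi> i j t) C2 = \<phi> 0 j False"
proof -
  have "(i mod m + j mod m + x) mod m = (i + j + x) mod m" for x
    by (intro mod_add_cong mod_add_eq refl)
  then show "zigzag_label (\<phi> i j t) C0 = \<phi> (i + j + of_bool t) 0 False"
    by (simp add: zigzag_label_def \<phi>_def)
qed (simp_all add: zigzag_label_def \<phi>_def)

text \<open>Since \<open>side\<close> changes along every edge, a face avoids the same colour
  throughout, so the colour itself is part of the invariant.\<close>

lemma zigzag_label_face:
  assumes "v \<in> V" "w \<in> V" "face side w l = face side v k"
  shows "l = k \<and> zigzag_label w l = zigzag_label v k"
proof -
  have "(l, zigzag_label w l) = (k, zigzag_label v k)"
  proof (rule net.face_at_constant[where L = "\<lambda>v k. (k, zigzag_label v k)", OF _ assms])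
    fix v c assume "v \<in> V"
    then obtain i j t where "v = \<phi> i j t" by (rule VE)
    then show "(turn (\<not> side (r c v)) c, zigzag_label (r c v) (turn (\<not> side (r c v)) c)) =
        (turn (side v) c, zigzag_label v (turn (side v) c))"
      by (cases t; cases c) (simp_all add: add_ac)
  qed
  then show ?thesis unfolding prod.inject .
qed

lemma proper_signs_zigzag: "net.proper_signs side"
  unfolding net.proper_signs_def
proof (intro conjI ballI allI impI)
  fix v assume "v \<in> V"
  then show "inj (face side v)"
    by (intro injI) (use zigzag_label_face in blast)
next
  fix v x i j k i' j'
  assume v: "v \<in> V" and x: "x \<in> V" and ijk: "distinct [i, j, k :: colour]"
    and i: "face side v i = face side x i'" and j: "face side v j = face side x j'"
  obtain p1 p2 t where v_eq: "v = \<phi> p1 p2 t" using v by (rule VE)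
  obtain x1 x2 u where x_eq: "x = \<phi> x1 x2 u" using x by (rule VE)
  \<comment> \<open>The common faces avoid \<open>i\<close> and \<open>j\<close> at both vertices,
    so all labels but that of colour \<open>k\<close> agree.\<close>
  have lab: "zigzag_label v l = zigzag_label x l" if "k \<noteq> l" for l
    using zigzag_label_face[OF x v i] zigzag_label_face[OF x v j] third_colour[OF ijk, of l] that by auto
  have dvd: "k = C0 \<or> m dvd (p1 + p2 + of_bool t) - (x1 + x2 + of_bool u)" "k = C1 \<or> m dvd p1 - x1"
    "k = C2 \<or> m dvd p2 - x2"
    using lab[of C0] lab[of C1] lab[of C2] by (cases k; simp add: v_eq x_eq \<phi>_eq_iff)+
  \<comment> \<open>Two labels determine \<open>x\<close> up to its side; \<open>d\<close> accounts
    for the shift along the edge of colour \<open>k\<close> when the sides differ.\<close>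
  define d :: int where "d = of_bool t - of_bool u"
  have "x = \<phi> (p1 + (if k = C1 then d else 0)) (p2 + (if k = C2 then d else 0)) u"
  proof (cases k)
    case C0
    then show ?thesis
      using dvd by (simp add: x_eq \<phi>_eq_iff dvd_diff_commute)
  next
    case C1
    then have "m dvd (p1 + p2 + of_bool t) - (x1 + x2 + of_bool u)" and 1: "m dvd p2 - x2"
      using dvd by simp_all
    then have "m dvd (p1 + p2 + of_bool t) - (x1 + x2 + of_bool u) - (p2 - x2)"
      by (rule dvd_diff)
    also have "(p1 + p2 + of_bool t) - (x1 + x2 + of_bool u) - (p2 - x2) = p1 + d - x1"
      by (simp add: d_def)
    finally have "m dvd p1 + d - x1" .
    with 1 show ?thesis
      using C1 by (simp add: x_eq \<phi>_eq_iff dvd_diff_commute)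
  next
    case C2
    then have "m dvd (p1 + p2 + of_bool t) - (x1 + x2 + of_bool u)" and 1: "m dvd p1 - x1"
      using dvd by simp_all
    then have "m dvd (p1 + p2 + of_bool t) - (x1 + x2 + of_bool u) - (p1 - x1)"
      by (rule dvd_diff)
    also have "(p1 + p2 + of_bool t) - (x1 + x2 + of_bool u) - (p1 - x1) = p2 + d - x2"
      by (simp add: d_def)
    finally have "m dvd p2 + d - x2" .
    with 1 show ?thesis
      using C2 by (simp add: x_eq \<phi>_eq_iff dvd_diff_commute)
  qed
  then show "x = v \<or> x = r k v"
    unfolding v_eq d_def by (cases t; cases u; cases k) auto
qed

text \<open>Two steps along a zigzag change one coordinate by a unit, or both in opposite
  directions, so each corner slides to an axis.\<close>

lemma face_zigzag_label:
  assumes "v \<in> V"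
  shows "face side v k = face side (zigzag_label v k) k"
proof -
  have *: "face side (r c v) k = face side v k" if "v \<in> V" "k \<noteq> c" for v c k
    using net.face_at_trans[of v side c k] that by simp
  have up: "face side (\<phi> i j False) C1 = face side (\<phi> i 0 False) C1" for i j
  proof -
    have "face side (\<phi> i (j + 1) False) C1 = face side (\<phi> i j False) C1" for j
      using *[of "\<phi> i j False" C1 C0] *[of "\<phi> i j True" C1 C2] by simp
    from this[of "_ - 1"] this show ?thesis
      by (induction j rule: int_induct[of _ 0]) simp_all
  qed
  have right: "face side (\<phi> i j False) C2 = face side (\<phi> 0 j False) C2" for i j
  proof -
    have "face side (\<phi> (i + 1) j False) C2 = face side (\<phi> i j False) C2" for i
      using *[of "\<phi> i j False" C2 C0] *[of "\<phi> i j True" C2 C1] by simp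
    from this[of "_ - 1"] this show ?thesis
      by (induction i rule: int_induct[of _ 0]) simp_all
  qed
  have diagonal: "face side (\<phi> i j False) C0 = face side (\<phi> (i + j) 0 False) C0" for i j
  proof -
    have step: "face side (\<phi> (i + 1) (j - 1) False) C0 = face side (\<phi> i j False) C0" for i j
      using *[of "\<phi> i j False" C0 C2] *[of "\<phi> i (j - 1) True" C0 C1] by simp
    show ?thesis
    proof (induction j arbitrary: i rule: int_induct[of _ 0])
      case (step1 j)
      then show ?case using step[of i "j + 1"] by (simp add: algebra_simps)
    next
      case (step2 j)
      then show ?case using step[of "i - 1" j] by (simp add: algebra_simps)
    qed simp
  qed
  obtain i j t where v: "v = \<phi> i j t" using assms by (rule VE)
  show ?thesis
  proof (cases t)
    case False
    then show ?thesis using v up right diagonal by (cases k) simp_all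
  next
    case True
    show ?thesis
      using v True up[of i j] right[of i j] diagonal[of "i + 1" j]
        *[of "\<phi> i j True" C0 C1] *[of "\<phi> i j True" C1 C0] *[of "\<phi> i j True" C2 C0]
      by (cases k) (simp_all add: add_ac)
  qed
qed

lemma card_faces_zigzag: "int (card (faces net.G (net.rot side))) = 3 * m"
proof -
  \<comment> \<open>Zigzags avoiding \<open>C2\<close> are labelled on the second axis, all others
    on the first; each colour gives \<open>m\<close> of them.\<close>
  let ?v = "\<lambda>k i. if k = C2 then \<phi> 0 i False else \<phi> i 0 False"
  let ?f = "\<lambda>(k, i). face side (?v k i) k"
  have lab: "zigzag_label (?v k i) k = ?v k i" for k i
    by (cases k) simp_all
  have "faces net.G (net.rot side) = ?f ` (UNIV \<times> {0..<m})"
  proof (intro equalityI subsetI)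
    fix f assume "f \<in> faces net.G (net.rot side)"
    then obtain v k where v: "v \<in> V" "f = face side v k" by (auto simp: net.faces_eq)
    obtain i j t where "v = \<phi> i j t" using v(1) by (rule VE)
    then have "\<exists>i. zigzag_label v k = ?v k i" by (cases k) auto
    then obtain i where "zigzag_label v k = ?v k i" by blast
    then have "f = ?f (k, i mod m)"
      using v face_zigzag_label[of v k] by auto
    then show "f \<in> ?f ` (UNIV \<times> {0..<m})"
      using m_gt by (intro image_eqI[of _ _ "(k, i mod m)"]) auto
  qed (auto simp: net.faces_eq)
  moreover have "inj_on ?f (UNIV \<times> {0..<m})"
  proof (rule inj_onI)
    fix x y assume *: "x \<in> UNIV \<times> {0..<m}" "y \<in> UNIV \<times> {0..<m}" "?f x = ?f y"
    obtain k i k' i' where xy: "x = (k, i)" "y = (k', i')" by (cases x; cases y)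
    have "k = k' \<and> zigzag_label (?v k i) k = zigzag_label (?v k' i') k'"
      using *(3) by (intro zigzag_label_face) (simp_all add: xy)
    then have "k = k' \<and> ?v k i = ?v k i'" unfolding lab by auto
    then show "x = y"
      using \<phi>_inj[of i 0 False i' 0 False] \<phi>_inj[of 0 i False 0 i' False] * m_gt
      by (auto simp: xy split: if_splits)
  qed
  ultimately have "card (faces net.G (net.rot side)) = card ((UNIV :: colour set) \<times> {0..<m})"
    by (simp add: card_image)
  then show ?thesis
    using m_gt by (simp add: card_cartesian_product UNIV_colour)
qed

section \<open>Genera and uniqueness\<close>

lemma has_genus_torus: "has_genus net.G (net.rot (\<lambda>_. True)) 1"
  by (simp add: has_genus_def card_V card_edges card_faces_torus)

text \<open>Euler's formula reads \<open>2 * m^2 - 3 * m^2 + 3 * m = 2 - 2 * g\<close>, which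
  rearranges to the assumption.\<close>

lemma has_genus_zigzag:
  assumes "2 * int g = (m - 1) * (m - 2)"
  shows "has_genus net.G (net.rot side) g"
  using assms
  by (simp add: has_genus_def card_V card_edges card_faces_zigzag power2_eq_square algebra_simps)

text \<open>Only signs on \<open>V\<close> matter, and negating all of them gives the mirror
  image.\<close>

lemma same_embedding_rot:
  assumes "(\<forall>v\<in>V. s' v = s v) \<or> (\<forall>v\<in>V. s' v = (\<not> s v))"
  shows "same_embedding (net.rot s) (net.rot s')"
  using assms net.rot_cong[of s' s] net.rot_cong[of s' "\<lambda>v. \<not> s v"]
  by (auto simp: same_embedding_def mirror_image_def net.inv_rot)

lemma polyhedral_embedding_unique:
  assumes "polyhedral_embedding net.G nx"
  shows "same_embedding (net.rot (\<lambda>_. True)) nx \<or> same_embedding (net.rot side) nx"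
proof -
  have "rotation_system net.G nx"
    using assms by (simp add: polyhedral_embedding_def embedding_def)
  then obtain s where nx: "nx = net.rot s" by (rule net.rotation_systemE)
  have "net.proper_signs s"
    using assms unfolding nx by (rule net.polyhedral_rot_imp_proper_signs)
  then interpret proper_hexagonal_net V r side q s
    by unfold_locales
  have const: "\<forall>v\<in>V. p v = p (\<phi> 0 0 False)" if "\<forall>v\<in>V. \<forall>k. p (r k v) = p v" for p :: "nat \<Rightarrow> bool"
    using net.V_induct[OF \<phi>_in, of "\<lambda>v. p v = p (\<phi> 0 0 False)" 0 0 False] that by blast
  from constant_or_alternating show ?thesis
  proof
    assume "\<forall>v\<in>V. \<forall>k. s (r k v) = s v"
    then have c: "\<forall>v\<in>V. s v = s (\<phi> 0 0 False)" by (rule const)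
    have "same_embedding (net.rot (\<lambda>_. True)) nx"
      unfolding nx
      by (rule same_embedding_rot, cases "s (\<phi> 0 0 False)") (use c in blast)+
    then show ?thesis ..
  next
    assume "\<forall>v\<in>V. \<forall>k. s (r k v) \<noteq> s v"
    \<comment> \<open>Both \<open>s\<close> and \<open>side\<close> change along every edge, so
      whether they agree is constant.\<close>
    then have "\<forall>v\<in>V. \<forall>k. (s (r k v) = side (r k v)) = (s v = side v)" by simp
    then have c: "\<forall>v\<in>V. (s v = side v) = (s (\<phi> 0 0 False) = side (\<phi> 0 0 False))"
      by (rule const)
    have "same_embedding (net.rot side) nx"
      unfolding nx
      by (rule same_embedding_rot, cases "s (\<phi> 0 0 False) = side (\<phi> 0 0 False)") (use c in blast)+
    then show ?thesis ..
  qed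
qed

end

theorem lemma7:
  shows "infinite {n :: nat. \<exists>G :: nat pair_pre_digraph.
           pair_graph G \<and> cubic G \<and> card (pverts G) = n \<and>
           (\<exists>nx1 nx2 g.
              polyhedral_embedding G nx1 \<and> has_genus G nx1 1 \<and>
              polyhedral_embedding G nx2 \<and> has_genus G nx2 g \<and>
              real g = real n / 4 - 3 / 2 * sqrt (real n / 2) + 1 \<and>
              (\<forall>nx. polyhedral_embedding G nx \<longrightarrow>
                 same_embedding nx1 nx \<or> same_embedding nx2 nx))}"
  (is "infinite ?S")
  unfolding infinite_nat_iff_unbounded
proof
  fix b :: nat
  \<comment> \<open>This makes \<open>q\<close> positive and \<open>m\<close>, hence the number of
    vertices, larger than \<open>b\<close>.\<close>
  define q where "q = b + 1"
  interpret hexagonal_torus q by unfold_locales (simp add: q_def)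
  define g where "g = nat ((m - 1) * (m - 2) div 2)"
  have "even ((m - 1) * (m - 2))" by simp
  moreover have "0 \<le> (m - 1) * (m - 2)" using m_gt by simp
  ultimately have g: "2 * int g = (m - 1) * (m - 2)" by (simp add: g_def)
  let ?n = "card V"
  have n: "real ?n = 2 * (of_int m)\<^sup>2"
    using arg_cong[OF card_V, of real_of_int] by simp
  have "2 * real g = (of_int m - 1) * (of_int m - 2)"
    using arg_cong[OF g, of real_of_int] by simp
  moreover have "sqrt (real ?n / 2) = of_int m"
    using m_gt by (simp add: n)
  ultimately have genus: "real g = real ?n / 4 - 3 / 2 * sqrt (real ?n / 2) + 1"
    by (simp add: n power2_eq_square algebra_simps)
  have "?n \<in> ?S"
  proof (intro CollectI exI conjI allI impI)
    show "pair_graph net.G" by (rule net.pair_graph_G)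
    show "cubic net.G" by (rule net.cubic_G)
    show "card (pverts net.G) = ?n" by simp
    show "polyhedral_embedding net.G (net.rot (\<lambda>_. True))"
      by (rule net.proper_signs_imp_polyhedral_rot[OF proper_signs_torus])
    show "has_genus net.G (net.rot (\<lambda>_. True)) 1" by (rule has_genus_torus)
    show "polyhedral_embedding net.G (net.rot side)"
      by (rule net.proper_signs_imp_polyhedral_rot[OF proper_signs_zigzag])
    show "has_genus net.G (net.rot side) g" by (rule has_genus_zigzag[OF g])
  qed (fact genus, rule polyhedral_embedding_unique)
  moreover have "b < ?n"
  proof -
    have "int b < m" unfolding m_def by (simp add: q_def)
    also have "m \<le> 2 * m\<^sup>2" using m_gt by (simp add: power2_eq_square)
    finally show ?thesis using card_V by simp
  qed
  ultimately show "\<exists>n>b. n \<in> ?S" by blast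
qed

end
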